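(* Let $\lambda$ and $\mu$ be partitions with $\lambda\supseteq\mu$ (i.e. $\lambda_i\ge\mu_i$ for all $i$), and let $n=|Y(\lambda/\mu)|$. Let $\ldots,z_{-2},z_{-1},z_0,z_1,z_2,\ldots$ be commuting indeterminates, and work in the field of rational functions in them over $\mathbb{Q}$. For a standard tableau $T$ of shape $\lambda/\mu$ put $$\mathbf{z}_T:=\frac{1}{\prod_{k=1}^{n}\left(z_{c_T(k)}+z_{c_T(k+1)}+\cdots+z_{c_T(n)}\right)}.$$ For a box $c\in Y(\lambda)$ put $h_\lambda(c;z):=\sum_{(p,q)\in H_\lambda(c)} z_{q-p}$. Then $$\sum_{T\in\operatorname{SYT}(\lambda/\mu)}\mathbf{z}_T=\sum_{E\in\mathcal{E}(\lambda/\mu)}\ \prod_{c\in Y(\lambda)\setminus E}\frac{1}{h_\lambda(c;z)}.$$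
   Context: A partition is a weakly decreasing sequence $\lambda=(\lambda_1,\lambda_2,\ldots)$ of nonnegative integers, eventually zero. A box is a pair $(i,j)\in\mathbb{Z}^2$; a diagram is a finite set of boxes. For partitions $\lambda\supseteq\mu$, $Y(\lambda/\mu)$ is the set of pairs $(i,j)$ of positive integers with $\mu_i<j\le\lambda_i$, and $Y(\lambda)=Y(\lambda/\varnothing)$. A standard tableau of shape $\lambda/\mu$ is a bijection $T:Y(\lambda/\mu)\to\{1,\ldots,n\}$ ($n=|Y(\lambda/\mu)|$) with $T(i,j)<T(i,j+1)$ and $T(i,j)<T(i+1,j)$ whenever both boxes lie in $Y(\lambda/\mu)$; $\operatorname{SYT}(\lambda/\mu)$ is the set of these. For $k\in\{1,\ldots,n\}$, $c_T(k):=j-i$ where $(i,j)$ is the box with $T(i,j)=k$. For $c=(i,j)\in Y(\lambda)$, the hook is $H_\lambda(c)=\{(i,k)\in Y(\lambda): k\ge j\}\cup\{(k,j)\in Y(\lambda): k\ge i\}$. Excited move: if a diagram $D$ contains a box $c=(i,j)$ but none of $(i+1,j),(i,j+1),(i+1,j+1)$, one may replace $D$ by $(D\setminus\{c\})\cup\{(i+1,j+1)\}$. A diagram $E$ is an excitation of $D$ if it is obtained from $D$ by a finite (possibly empty) sequence of excited moves. $\mathcal{E}(\lambda/\mu)$ is the set of all excitations $E$ of $Y(\mu)$ with $E\subseteq Y(\lambda)$. *)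

theory Defs
  imports
    Complex_Main
    "HOL-Library.Poly_Mapping"
    "HOL-Library.FuncSet"
    "HOL-Computational_Algebra.Fraction_Field"
begin

text \<open>Partitions are 1-based sequences as in the literature; the value at index 0 is ignored.\<close>

definition is_partition :: "(nat \<Rightarrow> nat) \<Rightarrow> bool" where
  "is_partition lam \<longleftrightarrow> (\<forall>i\<ge>1. lam (Suc i) \<le> lam i) \<and> (\<exists>N. \<forall>i\<ge>N. lam i = 0)"

definition part_contains :: "(nat \<Rightarrow> nat) \<Rightarrow> (nat \<Rightarrow> nat) \<Rightarrow> bool" where
  "part_contains lam mu \<longleftrightarrow> (\<forall>i\<ge>1. mu i \<le> lam i)"

type_synonym box = "int \<times> int"

definition skew_diagram :: "(nat \<Rightarrow> nat) \<Rightarrow> (nat \<Rightarrow> nat) \<Rightarrow> box set" where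
  "skew_diagram lam mu =
     {(i, j). 1 \<le> i \<and> 1 \<le> j \<and> int (mu (nat i)) < j \<and> j \<le> int (lam (nat i))}"

definition diagram :: "(nat \<Rightarrow> nat) \<Rightarrow> box set" where
  "diagram lam = skew_diagram lam (\<lambda>_. 0)"

text \<open>
  A tableau, as a map on the diagram, is encoded as a total function that is undefined outside
  the diagram, so that distinct functions are distinct tableaux.
\<close>

definition SYT :: "(nat \<Rightarrow> nat) \<Rightarrow> (nat \<Rightarrow> nat) \<Rightarrow> (box \<Rightarrow> nat) set" where
  "SYT lam mu = (let Y = skew_diagram lam mu in
     {T \<in> extensional Y. bij_betw T Y {1..card Y} \<and>
        (\<forall>i j. (i, j) \<in> Y \<and> (i, j + 1) \<in> Y \<longrightarrow> T (i, j) < T (i, j + 1)) \<and>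
        (\<forall>i j. (i, j) \<in> Y \<and> (i + 1, j) \<in> Y \<longrightarrow> T (i, j) < T (i + 1, j))})"

definition tab_content :: "box set \<Rightarrow> (box \<Rightarrow> nat) \<Rightarrow> nat \<Rightarrow> int" where
  "tab_content Y T k = (case the_inv_into Y T k of (i, j) \<Rightarrow> j - i)"

definition hook :: "(nat \<Rightarrow> nat) \<Rightarrow> box \<Rightarrow> box set" where
  "hook lam c = (case c of (i, j) \<Rightarrow>
     {(i, k) | k. (i, k) \<in> diagram lam \<and> j \<le> k} \<union>
     {(k, j) | k. (k, j) \<in> diagram lam \<and> i \<le> k})"

definition excited_move :: "box set \<Rightarrow> box set \<Rightarrow> bool" where
  "excited_move D D' \<longleftrightarrow> (\<exists>i j. (i, j) \<in> D \<and>
     (i + 1, j) \<notin> D \<and> (i, j + 1) \<notin> D \<and> (i + 1, j + 1) \<notin> D \<and>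
     D' = (D - {(i, j)}) \<union> {(i + 1, j + 1)})"

definition excitations :: "(nat \<Rightarrow> nat) \<Rightarrow> (nat \<Rightarrow> nat) \<Rightarrow> box set set" where
  "excitations lam mu = {E. excited_move\<^sup>*\<^sup>* (diagram mu) E \<and> E \<subseteq> diagram lam}"

text \<open>
  Polynomials over the rationals in the indeterminates indexed by the integers: finitely supported
  coefficient functions on monomials, which are finitely supported exponent functions.
  Their fraction field is the field of rational functions.
\<close>

type_synonym zpoly = "(int \<Rightarrow>\<^sub>0 nat) \<Rightarrow>\<^sub>0 rat"
type_synonym zratfun = "zpoly fract"

definition zvar :: "int \<Rightarrow> zratfun" where
  "zvar m = Fract (Poly_Mapping.single (Poly_Mapping.single m 1) 1) 1"

definition z_tab :: "(nat \<Rightarrow> nat) \<Rightarrow> (nat \<Rightarrow> nat) \<Rightarrow> (box \<Rightarrow> nat) \<Rightarrow> zratfun" where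
  "z_tab lam mu T = (let Y = skew_diagram lam mu; n = card Y in
     1 / (\<Prod>k=1..n. \<Sum>l=k..n. zvar (tab_content Y T l)))"

definition hook_weight :: "(nat \<Rightarrow> nat) \<Rightarrow> box \<Rightarrow> zratfun" where
  "hook_weight lam c = (\<Sum>(p, q)\<in>hook lam c. zvar (q - p))"

end

theory Submission
  imports Defs
begin

text \<open>
  Multiply the right-hand side by the product of all hook weights: it becomes
  \<open>s(\<lambda>, \<mu>) = \<Sum>\<^sub>E \<Prod>{h(c). c \<in> E}\<close>. The theorem follows by induction on the size of the skew shape from
  the recursion (Konvalinka; the equivariant Chevalley formula)
  \<open>(\<Sum>\<^sub>c z(c)) s(\<lambda>, \<mu>) = \<Sum>\<^sub>\<nu> s(\<lambda>, \<nu>)\<close>, where \<open>c\<close> runs over the skew shape and \<open>\<nu>\<close> over the shapes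
  obtained from \<open>\<mu>\<close> by adding a box; on the tableau side this is the removal of the entry 1.

  The recursion is proved by induction on \<open>\<lambda>\<close>. Write \<open>z(m) = w(m) - w(m - 1)\<close>; by telescoping, the
  weight of a hook is a difference of two values of \<open>w\<close>. Removing a corner \<open>b\<close> of content \<open>k\<close> from
  \<open>\<lambda>\<close> amounts, for the remaining hooks, to exchanging \<open>w(k)\<close> and \<open>w(k - 1)\<close>. An excited diagram
  containing \<open>b\<close> is \<open>b\<close> together with an excited diagram of \<open>\<mu>\<close> minus its corner \<open>a\<close> of content \<open>k\<close>. So
  \<open>s(\<lambda>, \<mu>) = f(\<mu>) + z(k) f(\<mu> - a)\<close>, where \<open>f\<close> is \<open>s(\<lambda> - b, _)\<close> with the exchanged variables and
  the last term is absent if \<open>\<mu>\<close> has no such corner. The exchange changes the total weight of \<open>\<mu>\<close>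
  by \<open>z(k)\<close> times a second difference of diagonal lengths, which detects whether a box of content
  \<open>k\<close> can be added to or removed from \<open>\<mu>\<close>.
\<close>

section \<open>Order ideals of boxes\<close>

text \<open>Young diagrams are encoded as finite order ideals of the positive quadrant, because
  adding and removing single boxes is easier on sets than on sequences; partitions return only at
  the end.\<close>

definition young :: "box set \<Rightarrow> bool" where
  "young S \<longleftrightarrow> finite S \<and> (\<forall>i j. (i, j) \<in> S \<longrightarrow> 1 \<le> i \<and> 1 \<le> j) \<and>
     (\<forall>i j i' j'. (i, j) \<in> S \<and> 1 \<le> i' \<and> i' \<le> i \<and> 1 \<le> j' \<and> j' \<le> j \<longrightarrow> (i', j') \<in> S)"

definition content :: "box \<Rightarrow> int" where
  "content c = snd c - fst c"

definition addable :: "box set \<Rightarrow> box set" where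
  "addable M = {a. a \<notin> M \<and> young (insert a M)}"

definition removable :: "box set \<Rightarrow> box set" where
  "removable M = {a \<in> M. young (M - {a})}"

lemma content_pair [simp]: "content (i, j) = j - i"
  by (simp add: content_def)

lemma young_finite: "young S \<Longrightarrow> finite S"
  unfolding young_def by (elim conjE)

lemma young_pos: "young S \<Longrightarrow> (i, j) \<in> S \<Longrightarrow> 1 \<le> i \<and> 1 \<le> j"
  unfolding young_def by blast

lemma young_down:
  "young S \<Longrightarrow> (i, j) \<in> S \<Longrightarrow> 1 \<le> i' \<Longrightarrow> i' \<le> i \<Longrightarrow> 1 \<le> j' \<Longrightarrow> j' \<le> j \<Longrightarrow> (i', j') \<in> S"
  unfolding young_def by blast

lemma young_empty [simp]: "young {}"
  by (simp add: young_def)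

lemma youngI:
  assumes "finite S" "\<And>i j. (i, j) \<in> S \<Longrightarrow> 1 \<le> i" "\<And>i j. (i, j) \<in> S \<Longrightarrow> 1 \<le> j"
    and "\<And>i j i' j'. (i, j) \<in> S \<Longrightarrow> 1 \<le> i' \<Longrightarrow> i' \<le> i \<Longrightarrow> 1 \<le> j' \<Longrightarrow> j' \<le> j \<Longrightarrow> (i', j') \<in> S"
  shows "young S"
  unfolding young_def using assms(1-3)
  by (intro conjI allI impI) (simp_all, elim conjE, rule assms(4))

lemma young_Un:
  assumes "young A" "young B"
  shows "young (A \<union> B)"
proof (rule youngI)
  fix i j i' j'
  assume "(i, j) \<in> A \<union> B" "1 \<le> i'" "i' \<le> i" "1 \<le> j'" "j' \<le> j"
  then show "(i', j') \<in> A \<union> B"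
    using young_down[OF assms(1), of i j i' j'] young_down[OF assms(2), of i j i' j'] by auto
qed (use assms in \<open>auto dest: young_finite young_pos\<close>)

lemma young_Int:
  assumes "young A" "young B"
  shows "young (A \<inter> B)"
proof (rule youngI)
  fix i j i' j'
  assume "(i, j) \<in> A \<inter> B" "1 \<le> i'" "i' \<le> i" "1 \<le> j'" "j' \<le> j"
  then show "(i', j') \<in> A \<inter> B"
    using young_down[OF assms(1), of i j i' j'] young_down[OF assms(2), of i j i' j'] by auto
qed (use assms in \<open>auto dest: young_finite young_pos\<close>)

lemma addable_iff:
  assumes "young M"
  shows "(i, j) \<in> addable M \<longleftrightarrow> 1 \<le> i \<and> 1 \<le> j \<and> (i, j) \<notin> M \<and>
           (i = 1 \<or> (i - 1, j) \<in> M) \<and> (j = 1 \<or> (i, j - 1) \<in> M)" (is "?l \<longleftrightarrow> ?r")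
proof
  assume ?l
  then have n: "(i, j) \<notin> M" and y: "young (insert (i, j) M)"
    by (auto simp: addable_def)
  have p: "1 \<le> i \<and> 1 \<le> j"
    using young_pos[OF y, of i j] by simp
  have "i = 1 \<or> (i - 1, j) \<in> M"
    using young_down[OF y, of i j "i - 1" j] p by (cases "i = 1") auto
  moreover have "j = 1 \<or> (i, j - 1) \<in> M"
    using young_down[OF y, of i j i "j - 1"] p by (cases "j = 1") auto
  ultimately show ?r using n p by simp
next
  assume r: ?r
  \<comment> \<open>A box northwest of \<open>(i, j)\<close> and different from it is already
    northwest of one of the two predecessors \<open>(i - 1, j)\<close> and
    \<open>(i, j - 1)\<close>.\<close>
  have d: "(x, y) \<in> insert (i, j) M" if "1 \<le> x" "x \<le> i" "1 \<le> y" "y \<le> j" for x y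
  proof (cases "x = i \<and> y = j")
    case False
    then consider "x \<le> i - 1" | "y \<le> j - 1" using \<open>x \<le> i\<close> \<open>y \<le> j\<close> by linarith
    then show ?thesis
    proof cases
      case 1
      then have "(i - 1, j) \<in> M" using r that by auto
      then show ?thesis using young_down[OF assms, of "i - 1" j x y] 1 that by auto
    next
      case 2
      then have "(i, j - 1) \<in> M" using r that by auto
      then show ?thesis using young_down[OF assms, of i "j - 1" x y] 2 that by auto
    qed
  qed simp
  have "young (insert (i, j) M)"
  proof (rule youngI)
    show "finite (insert (i, j) M)" using young_finite[OF assms] by simp
  next
    fix x y assume "(x, y) \<in> insert (i, j) M"
    then show "1 \<le> x" using r young_pos[OF assms, of x y] by auto
  next
    fix x y assume "(x, y) \<in> insert (i, j) M"
    then show "1 \<le> y" using r young_pos[OF assms, of x y] by auto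
  next
    fix x y x' y'
    assume a: "(x, y) \<in> insert (i, j) M" "1 \<le> x'" "x' \<le> x" "1 \<le> y'" "y' \<le> y"
    show "(x', y') \<in> insert (i, j) M"
    proof (cases "(x, y) = (i, j)")
      case True
      then show ?thesis using d[of x' y'] a by simp
    next
      case False
      then show ?thesis using a young_down[OF assms, of x y x' y'] by auto
    qed
  qed
  then show ?l using r by (simp add: addable_def)
qed

lemma removable_iff:
  assumes "young M"
  shows "(i, j) \<in> removable M \<longleftrightarrow> (i, j) \<in> M \<and> (i + 1, j) \<notin> M \<and> (i, j + 1) \<notin> M" (is "?l \<longleftrightarrow> ?r")
proof
  assume ?l
  then have n: "(i, j) \<in> M" and y: "young (M - {(i, j)})"
    by (auto simp: removable_def)
  have p: "1 \<le> i \<and> 1 \<le> j"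
    using young_pos[OF assms n] by simp
  show ?r
    using young_down[OF y, of "i + 1" j i j] young_down[OF y, of i "j + 1" i j] n p by auto
next
  assume r: ?r
  then have p: "1 \<le> i" "1 \<le> j"
    using young_pos[OF assms] by auto
  have "young (M - {(i, j)})"
  proof (rule youngI)
    show "finite (M - {(i, j)})" using young_finite[OF assms] by simp
  next
    fix x y assume "(x, y) \<in> M - {(i, j)}"
    then show "1 \<le> x" using young_pos[OF assms, of x y] by auto
  next
    fix x y assume "(x, y) \<in> M - {(i, j)}"
    then show "1 \<le> y" using young_pos[OF assms, of x y] by auto
  next
    fix x y x' y'
    assume a: "(x, y) \<in> M - {(i, j)}" "1 \<le> x'" "x' \<le> x" "1 \<le> y'" "y' \<le> y"
    then have "(x', y') \<in> M" using young_down[OF assms, of x y x' y'] by auto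
    moreover have "(x', y') \<noteq> (i, j)"
    proof
      assume e: "(x', y') = (i, j)"
      with a have "(x, y) \<noteq> (i, j)" "i \<le> x" "j \<le> y" "(x, y) \<in> M" by auto
      then consider "i + 1 \<le> x" | "j + 1 \<le> y" by fastforce
      then show False
        using young_down[OF assms \<open>(x, y) \<in> M\<close>, of "i + 1" j]
          young_down[OF assms \<open>(x, y) \<in> M\<close>, of i "j + 1"] r p \<open>i \<le> x\<close> \<open>j \<le> y\<close>
        by cases auto
    qed
    ultimately show "(x', y') \<in> M - {(i, j)}" by simp
  qed
  then show ?l using r by (simp add: removable_def)
qed

section \<open>Finiteness and uniqueness of addable and removable boxes\<close>

lemma finite_addable:
  assumes "young M"
  shows "finite (addable M)"
proof -
  have "addable M \<subseteq> {(1, 1)} \<union> (\<lambda>(i, j). (i + 1, j)) ` M \<union> (\<lambda>(i, j). (i, j + 1)) ` M"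
  proof
    fix a assume a: "a \<in> addable M"
    obtain i j where ij: "a = (i, j)" by force
    have "i = 1 \<and> j = 1 \<or> (i - 1, j) \<in> M \<or> (i, j - 1) \<in> M"
      using a addable_iff[OF assms, of i j] ij by auto
    then show "a \<in> {(1, 1)} \<union> (\<lambda>(i, j). (i + 1, j)) ` M \<union> (\<lambda>(i, j). (i, j + 1)) ` M"
      using ij by force
  qed
  then show ?thesis
    by (rule finite_subset) (use young_finite[OF assms] in auto)
qed

text \<open>Of two addable boxes on one diagonal, the upper neighbour of the farther one would be in
  \<open>M\<close> and dominate the nearer one, which would put the nearer one in
  \<open>M\<close>.\<close>

lemma addable_unique:
  assumes "young M" "a \<in> addable M" "b \<in> addable M" "content a = content b"
  shows "a = b"
proof -
  have *: "\<not> i < x" if "(i, j) \<in> addable M" "(x, y) \<in> addable M" "j - i = y - x" for i j x y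
  proof
    assume "i < x"
    then have "(x - 1, y) \<in> M" "1 \<le> i" "1 \<le> j" "(i, j) \<notin> M"
      using that addable_iff[OF assms(1), of x y] addable_iff[OF assms(1), of i j] by auto
    then show False
      using young_down[OF assms(1), of "x - 1" y i j] \<open>i < x\<close> that by auto
  qed
  obtain i j x y where "a = (i, j)" "b = (x, y)" by force
  then show ?thesis
    using *[of i j x y] *[of x y i j] assms by auto
qed

text \<open>Of two boxes of \<open>M\<close> on one diagonal, the farther one dominates the lower
  neighbour of the nearer one, so the nearer one is not a corner.\<close>

lemma removable_unique:
  assumes "young M" "a \<in> removable M" "b \<in> removable M" "content a = content b"
  shows "a = b"
proof -
  have *: "\<not> i < x" if "(i, j) \<in> removable M" "(x, y) \<in> removable M" "j - i = y - x" for i j x y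
  proof
    assume "i < x"
    have "(x, y) \<in> M" "(i, j) \<in> M" "(i + 1, j) \<notin> M"
      using that removable_iff[OF assms(1), of x y] removable_iff[OF assms(1), of i j] by auto
    moreover have "1 \<le> i" "1 \<le> j"
      using young_pos[OF assms(1) \<open>(i, j) \<in> M\<close>] by auto
    ultimately show False
      using young_down[OF assms(1), of x y "i + 1" j] \<open>i < x\<close> that by auto
  qed
  obtain i j x y where "a = (i, j)" "b = (x, y)" by force
  then show ?thesis
    using *[of i j x y] *[of x y i j] assms by auto
qed

text \<open>An order ideal meets each diagonal in an initial segment. The number \<open>p\<close> is
  the row in which the diagonal has just left \<open>M\<close>; it encodes the length of the segment
  without reference to where the diagonal starts.\<close>

lemma diagonal_initial:
  assumes "young M"
  obtains p where "1 \<le> p" "1 \<le> p + k" "\<And>i. (i, i + k) \<in> M \<longleftrightarrow> 1 \<le> i \<and> 1 \<le> i + k \<and> i < p"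
proof -
  \<comment> \<open>The first row in which diagonal \<open>k\<close> lies in the quadrant;
    \<open>n\<close> is then the number of boxes of \<open>M\<close> on this diagonal.\<close>
  define m where "m = max 1 (1 - k)"
  define n where "n = (LEAST n::nat. (m + int n, m + int n + k) \<notin> M)"
  have "\<exists>n::nat. (m + int n, m + int n + k) \<notin> M"
  proof (rule ccontr)
    assume "\<nexists>n::nat. (m + int n, m + int n + k) \<notin> M"
    then have "range (\<lambda>n::nat. (m + int n, m + int n + k)) \<subseteq> M" by auto
    then have "finite (range (\<lambda>n::nat. (m + int n, m + int n + k)))"
      using young_finite[OF assms] finite_subset by blast
    moreover have "inj (\<lambda>n::nat. (m + int n, m + int n + k))"
      by (auto simp: inj_on_def)
    ultimately show False using finite_imageD infinite_UNIV_nat by blast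
  qed
  then have n: "(m + int n, m + int n + k) \<notin> M"
    unfolding n_def by (rule LeastI_ex)
  have l: "(m + int x, m + int x + k) \<in> M" if "x < n" for x
    using not_less_Least[of x "\<lambda>n. (m + int n, m + int n + k) \<notin> M"] that unfolding n_def by auto
  show thesis
  proof (rule that[of "m + int n"])
    show "1 \<le> m + int n" "1 \<le> m + int n + k" by (auto simp: m_def)
    fix i
    show "(i, i + k) \<in> M \<longleftrightarrow> 1 \<le> i \<and> 1 \<le> i + k \<and> i < m + int n" (is "?l \<longleftrightarrow> ?r")
    proof
      assume a: ?l
      then have "1 \<le> i \<and> 1 \<le> i + k" using young_pos[OF assms] by blast
      moreover have "i < m + int n"
      proof (rule ccontr)
        assume "\<not> i < m + int n"
        then have "(m + int n, m + int n + k) \<in> M"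
          by (intro young_down[OF assms a]) (auto simp: m_def)
        then show False using n by simp
      qed
      ultimately show ?r by simp
    next
      assume ?r
      then have "i = m + int (nat (i - m))" "nat (i - m) < n" by (auto simp: m_def)
      then show ?l using l[of "nat (i - m)"] by simp
    qed
  qed
qed

section \<open>Diagonal lengths and their second differences\<close>

definition diagonal_count :: "box set \<Rightarrow> int \<Rightarrow> int" where
  "diagonal_count M k = int (card {c \<in> M. content c = k})"

lemma diagonal_count_eq:
  assumes "\<And>i. (i, i + k) \<in> M \<longleftrightarrow> 1 \<le> i \<and> 1 \<le> i + k \<and> i < p" "1 \<le> p" "1 \<le> p + k"
  shows "diagonal_count M k = p - max 1 (1 - k)"
proof -
  have "{c \<in> M. content c = k} = (\<lambda>i. (i, i + k)) ` {max 1 (1 - k)..<p}"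
  proof (intro set_eqI iffI)
    fix c assume c: "c \<in> {c \<in> M. content c = k}"
    obtain i j where ij: "c = (i, j)" by force
    then have "j = i + k" using c by auto
    then show "c \<in> (\<lambda>i. (i, i + k)) ` {max 1 (1 - k)..<p}"
      using c ij assms(1)[of i] by auto
  next
    fix c assume "c \<in> (\<lambda>i. (i, i + k)) ` {max 1 (1 - k)..<p}"
    then obtain i where "c = (i, i + k)" "i \<in> {max 1 (1 - k)..<p}" by blast
    then show "c \<in> {c \<in> M. content c = k}"
      using assms(1)[of i] by simp
  qed
  then have "card {c \<in> M. content c = k} = card {max 1 (1 - k)..<p}"
    by (simp add: card_image inj_on_def)
  then show ?thesis using assms(2,3) by (simp add: diagonal_count_def)
qed

definition addable_at :: "box set \<Rightarrow> int \<Rightarrow> box set" where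
  "addable_at M k = {a \<in> addable M. content a = k}"

definition removable_at :: "box set \<Rightarrow> int \<Rightarrow> box set" where
  "removable_at M k = {a \<in> removable M. content a = k}"

text \<open>The correction at \<open>k = 0\<close> comes from the corner of the quadrant.\<close>
lemma second_difference_diagonal_count:
  assumes "young M"
  shows "diagonal_count M (k - 1) + diagonal_count M (k + 1) - 2 * diagonal_count M k +
           (if k = 0 then 1 else 0) =
         (if addable_at M k = {} then 0 else 1) - (if removable_at M k = {} then 0 else 1)"
proof -
  obtain p where p: "1 \<le> p" "1 \<le> p + k"
      "\<And>i. (i, i + k) \<in> M \<longleftrightarrow> 1 \<le> i \<and> 1 \<le> i + k \<and> i < p"
    using diagonal_initial[OF assms] by metis
  obtain q where q: "1 \<le> q" "1 \<le> q + (k + 1)"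
      "\<And>i. (i, i + (k + 1)) \<in> M \<longleftrightarrow> 1 \<le> i \<and> 1 \<le> i + (k + 1) \<and> i < q"
    using diagonal_initial[OF assms] by metis
  obtain r where r: "1 \<le> r" "1 \<le> r + (k - 1)"
      "\<And>i. (i, i + (k - 1)) \<in> M \<longleftrightarrow> 1 \<le> i \<and> 1 \<le> i + (k - 1) \<and> i < r"
    using diagonal_initial[OF assms] by metis
  have P: "(i, j) \<in> M \<longleftrightarrow> 1 \<le> i \<and> 1 \<le> j \<and> i < p" if "j - i = k" for i j
  proof -
    have "j = i + k" using that by simp
    then show ?thesis using p(3)[of i]  by simp
  qed
  have Q: "(i, j) \<in> M \<longleftrightarrow> 1 \<le> i \<and> 1 \<le> j \<and> i < q" if "j - i = k + 1" for i j
  proof -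
    have "j = i + (k + 1)" using that by simp
    then show ?thesis using q(3)[of i] by simp
  qed
  have R: "(i, j) \<in> M \<longleftrightarrow> 1 \<le> i \<and> 1 \<le> j \<and> i < r" if "j - i = k - 1" for i j
  proof -
    have "j = i + (k - 1)" using that by simp
    then show ?thesis using r(3)[of i]  by simp
  qed
  \<comment> \<open>The exit rows of neighbouring diagonals interlace: \<open>q\<close> is
    \<open>p - 1\<close> or \<open>p\<close>, and \<open>r\<close> is \<open>p\<close> or
    \<open>p + 1\<close>. Each violation would produce a box of \<open>M\<close> whose left or upper
    neighbour is missing.\<close>
  have "\<not> p < q"
    using young_down[OF assms, of p "p + k + 1" p "p + k"] P[of "p + k" p] Q[of "p + k + 1" p] p(1,2)
    by auto
  then have q1: "q \<le> p" by simp
  have "\<not> q + 1 < p"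
    using young_down[OF assms, of "p - 1" "p - 1 + k" "p - 2" "p - 1 + k"]
      P[of "p - 1 + k" "p - 1"] Q[of "p - 1 + k" "p - 2"] p(1,2) q(1,2)
    by auto
  then have q2: "p \<le> q + 1" by simp
  have "\<not> p + 1 < r"
    using young_down[OF assms, of "p + 1" "p + k" p "p + k"] P[of "p + k" p] R[of "p + k" "p + 1"] p(1,2)
    by auto
  then have r1: "r \<le> p + 1" by simp
  have "\<not> r < p"
    using young_down[OF assms, of "p - 1" "p - 1 + k" "p - 1" "p - 2 + k"]
      P[of "p - 1 + k" "p - 1"] R[of "p - 2 + k" "p - 1"] p(1,2) r(1,2)
    by auto
  then have r2: "p \<le> r" by simp
  \<comment> \<open>The only candidate is \<open>(p, p + k)\<close>. Its upper neighbour lies on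
    diagonal \<open>k + 1\<close> and requires \<open>p - 1 < q\<close>, its left neighbour lies on
    diagonal \<open>k - 1\<close> and requires \<open>p < r\<close>; at the border of the quadrant
    the bounds on \<open>q\<close> and \<open>r\<close> give the same.\<close>
  have a: "addable_at M k \<noteq> {} \<longleftrightarrow> q = p \<and> r = p + 1"
  proof
    assume "addable_at M k \<noteq> {}"
    then obtain c where c: "c \<in> addable M" "content c = k"
      unfolding addable_at_def by blast
    then obtain i j where ij: "(i, j) \<in> addable M" and j: "j = i + k"
      by (intro that[of "fst c" "snd c"]) (simp_all add: content_def)
    have "1 \<le> i \<and> 1 \<le> j \<and> \<not> i < p \<and> (i = 1 \<or> i - 1 < q) \<and> (j = 1 \<or> i < r)"
      using ij P[of j i] Q[of j "i - 1"] R[of "j - 1" i] unfolding addable_iff[OF assms] j by auto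
    then show "q = p \<and> r = p + 1"
      using p(1,2) q(1,2) r(1,2) q1 q2 r1 r2 j by presburger
  next
    assume qr: "q = p \<and> r = p + 1"
    have "(p, p + k) \<in> addable M"
      using P[of "p + k" p] Q[of "p + k" "p - 1"] R[of "p + k - 1" p] p(1,2) qr
      unfolding addable_iff[OF assms] by auto
    then show "addable_at M k \<noteq> {}" by (force simp: addable_at_def)
  qed
  \<comment> \<open>The only candidate is the last box \<open>(p - 1, p - 1 + k)\<close> of the
    diagonal; its right and lower neighbours must be absent from diagonals \<open>k + 1\<close> and
    \<open>k - 1\<close>.\<close>
  have b: "removable_at M k \<noteq> {} \<longleftrightarrow> q = p - 1 \<and> r = p"
  proof
    assume "removable_at M k \<noteq> {}"
    then obtain c where c: "c \<in> removable M" "content c = k"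
      unfolding removable_at_def by blast
    then obtain i j where ij: "(i, j) \<in> removable M" and j: "j = i + k"
      by (intro that[of "fst c" "snd c"]) (simp_all add: content_def)
    have "1 \<le> i \<and> 1 \<le> j \<and> i < p \<and> \<not> i < q \<and> \<not> i + 1 < r"
      using ij P[of j i] Q[of "j + 1" i] R[of j "i + 1"] unfolding removable_iff[OF assms] j by auto
    then show "q = p - 1 \<and> r = p"
      using q1 q2 r1 r2 by presburger
  next
    assume qr: "q = p - 1 \<and> r = p"
    have "(p - 1, p - 1 + k) \<in> removable M"
      using P[of "p - 1 + k" "p - 1"] Q[of "p + k" "p - 1"] R[of "p - 1 + k" p] p(1,2) q(1,2) r(1,2) qr
      unfolding removable_iff[OF assms] by auto
    then show "removable_at M k \<noteq> {}" by (force simp: removable_at_def)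
  qed
  \<comment> \<open>The starting rows of the diagonals are piecewise linear in \<open>k\<close> with
    a single bend at 0, which is the source of the correction term.\<close>
  have m: "max 1 (1 - (k - 1)) + max 1 (1 - (k + 1)) - 2 * max 1 (1 - k) = (if k = 0 then 1 else 0)"
    unfolding max_def by presburger
  have "diagonal_count M k = p - max 1 (1 - k)"
    by (rule diagonal_count_eq) (fact p)+
  moreover have "diagonal_count M (k + 1) = q - max 1 (1 - (k + 1))"
    by (rule diagonal_count_eq) (fact q)+
  moreover have "diagonal_count M (k - 1) = r - max 1 (1 - (k - 1))"
    by (rule diagonal_count_eq) (fact r)+
  moreover define u v w e where "u = max 1 (1 - k)" and "v = max 1 (1 - (k + 1))"
    and "w = max 1 (1 - (k - 1))" and "e = (if k = 0 then 1 else 0 :: int)"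
  ultimately have "diagonal_count M k = p - u" "diagonal_count M (k + 1) = q - v"
      "diagonal_count M (k - 1) = r - w" "w + v - 2 * u = e"
    using m by presburger+
  then have d: "diagonal_count M (k - 1) + diagonal_count M (k + 1) - 2 * diagonal_count M k + e
      = q + r - 2 * p"
    by linarith
  \<comment> \<open>Of the four configurations allowed by interlacing, the last two are neither
    addable nor removable at \<open>k\<close>, and there the second difference vanishes.\<close>
  consider "q = p" "r = p + 1" | "q = p - 1" "r = p" | "q = p" "r = p" | "q = p - 1" "r = p + 1"
    using q1 q2 r1 r2 by linarith
  then have "q + r - 2 * p = (if q = p \<and> r = p + 1 then 1 else 0) - (if q = p - 1 \<and> r = p then 1 else 0)"
    by cases simp_all
  then show ?thesis
    unfolding d[unfolded e_def] using a b by simp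
qed

section \<open>Excited diagrams as shifted order ideals\<close>

text \<open>The filling records how far each box is moved along its diagonal.\<close>
definition monotone_filling :: "box set \<Rightarrow> (box \<Rightarrow> nat) \<Rightarrow> bool" where
  "monotone_filling M t \<longleftrightarrow>
     (\<forall>i j i' j'. (i, j) \<in> M \<and> (i', j') \<in> M \<and> i \<le> i' \<and> j \<le> j' \<longrightarrow> t (i, j) \<le> t (i', j'))"

definition diagonal_shift :: "(box \<Rightarrow> nat) \<Rightarrow> box \<Rightarrow> box" where
  "diagonal_shift t c = (fst c + int (t c), snd c + int (t c))"

lemma diagonal_shift_pair: "diagonal_shift t (i, j) = (i + int (t (i, j)), j + int (t (i, j)))"
  by (simp add: diagonal_shift_def)

lemma diagonal_shift_imageE:
  assumes "b \<in> diagonal_shift t ` M"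
  obtains p q where "(p, q) \<in> M" "b = diagonal_shift t (p, q)"
  using assms by (metis imageE surj_pair)

lemma diagonal_shift_mem: "diagonal_shift t ` M \<subseteq> S \<Longrightarrow> (i, j) \<in> M \<Longrightarrow>
    (i + int (t (i, j)), j + int (t (i, j))) \<in> S"
  using diagonal_shift_pair by auto

lemma monotone_fillingD:
  "monotone_filling M t \<Longrightarrow> (i, j) \<in> M \<Longrightarrow> (i', j') \<in> M \<Longrightarrow> i \<le> i' \<Longrightarrow> j \<le> j' \<Longrightarrow>
    t (i, j) \<le> t (i', j')"
  unfolding monotone_filling_def by blast

lemma monotone_fillingI:
  assumes "\<And>i j i' j'. (i, j) \<in> M \<Longrightarrow> (i', j') \<in> M \<Longrightarrow> i \<le> i' \<Longrightarrow> j \<le> j' \<Longrightarrow> t (i, j) \<le> t (i', j')"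
  shows "monotone_filling M t"
  unfolding monotone_filling_def by (intro allI impI, elim conjE, rule assms)

text \<open>Boxes with the same image lie on one diagonal, hence are comparable, and a monotone
  filling never lets the nearer one catch up with the farther one.\<close>

lemma inj_on_diagonal_shift:
  assumes "monotone_filling M t"
  shows "inj_on (diagonal_shift t) M"
proof (rule inj_onI)
  fix a b assume ab: "a \<in> M" "b \<in> M" "diagonal_shift t a = diagonal_shift t b"
  obtain p q x y where pq: "a = (p, q)" "b = (x, y)" by force
  show "a = b"
    using monotone_fillingD[OF assms, of p q x y] monotone_fillingD[OF assms, of x y p q] ab pq
    by (cases "p \<le> x") (auto simp: diagonal_shift_pair)
qed

lemma diagonal_shift_update_image:
  assumes "monotone_filling M t" "a \<in> M"
  shows "diagonal_shift (t(a := u)) ` M =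
    insert (fst a + int u, snd a + int u) (diagonal_shift t ` M - {diagonal_shift t a})"
proof -
  have "diagonal_shift (t(a := u)) ` M =
      insert (diagonal_shift (t(a := u)) a) (diagonal_shift (t(a := u)) ` (M - {a}))"
    using assms(2) by blast
  also have "diagonal_shift (t(a := u)) ` (M - {a}) = diagonal_shift t ` (M - {a})"
    by (intro image_cong) (auto simp: diagonal_shift_def)
  also have "\<dots> = diagonal_shift t ` M - {diagonal_shift t a}"
    using inj_on_image_set_diff[OF inj_on_diagonal_shift[OF assms(1)], of M "{a}"] assms(2) by simp
  finally show ?thesis by (simp add: diagonal_shift_def)
qed

text \<open>A move of the box that started at \<open>(p, q)\<close> raises \<open>t (p, q)\<close>
  by one. Monotonicity survives because the vacant neighbours force strictly larger values on all
  boxes of \<open>M\<close> southeast of \<open>(p, q)\<close>.\<close>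

lemma excited_moves_imp_filling:
  assumes "young M" "excited_move\<^sup>*\<^sup>* M E"
  shows "\<exists>t. monotone_filling M t \<and> E = diagonal_shift t ` M"
  using assms(2)
proof (induction rule: rtranclp_induct)
  case base
  have "monotone_filling M (\<lambda>_. 0)" by (rule monotone_fillingI) simp
  moreover have "M = diagonal_shift (\<lambda>_. 0) ` M" by (simp add: diagonal_shift_def)
  ultimately show ?case by blast
next
  case (step D D')
  then obtain t where t: "monotone_filling M t" "D = diagonal_shift t ` M" by blast
  from step(2) obtain i j where ij: "(i, j) \<in> D" "(i + 1, j) \<notin> D" "(i, j + 1) \<notin> D"
      "D' = (D - {(i, j)}) \<union> {(i + 1, j + 1)}"
    unfolding excited_move_def by blast
  from ij(1) obtain p q where pq: "(p, q) \<in> M" "(i, j) = diagonal_shift t (p, q)"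
    unfolding t(2) by (rule diagonal_shift_imageE)
  then have i: "i = p + int (t (p, q))" and j: "j = q + int (t (p, q))"
    by (simp_all add: diagonal_shift_pair)
  let ?t = "t((p, q) := t (p, q) + 1)"
  have p: "1 \<le> p" "1 \<le> q" using young_pos[OF assms(1) pq(1)] by auto
  \<comment> \<open>With an equal value, the right or lower neighbour in \<open>M\<close> would
    occupy \<open>(i, j + 1)\<close> or \<open>(i + 1, j)\<close>, contrary to the condition for a
    move.\<close>
  have nbr: "t (p, q) < t (x, y)" if "(x, y) \<in> M" "(x, y) = (p + 1, q) \<or> (x, y) = (p, q + 1)" for x y
  proof -
    have "diagonal_shift t (x, y) \<in> D" unfolding t(2) using that(1) by (rule imageI)
    then have "(x + int (t (x, y)), y + int (t (x, y))) \<in> D" by (simp only: diagonal_shift_pair)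
    moreover have "(x + int (t (p, q)), y + int (t (p, q))) \<notin> D"
      using that(2) ij(2,3) unfolding i j by (elim disjE) (simp_all add: add_ac)
    ultimately have "t (x, y) \<noteq> t (p, q)" by metis
    moreover have "t (p, q) \<le> t (x, y)"
      by (rule monotone_fillingD[OF t(1) pq(1) that(1)]) (use that(2) in auto)
    ultimately show ?thesis by simp
  qed
  have above: "t (p, q) < t (x, y)" if "(x, y) \<in> M" "p \<le> x" "q \<le> y" "(x, y) \<noteq> (p, q)" for x y
  proof -
    show ?thesis
    proof (cases "p + 1 \<le> x")
      case 1: True
      then have m: "(p + 1, q) \<in> M" using young_down[OF assms(1) that(1), of "p + 1" q] p that(3) by simp
      show ?thesis
        using nbr[OF m] monotone_fillingD[OF t(1) m that(1) 1 that(3)] by simp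
    next
      case False
      then have 2: "q + 1 \<le> y" using that(2-4) by auto
      then have m: "(p, q + 1) \<in> M" using young_down[OF assms(1) that(1), of p "q + 1"] p that(2) by simp
      show ?thesis
        using nbr[OF m] monotone_fillingD[OF t(1) m that(1) that(2) 2] by simp
    qed
  qed
  have "monotone_filling M ?t"
  proof (rule monotone_fillingI)
    fix x y x' y' assume a: "(x, y) \<in> M" "(x', y') \<in> M" "x \<le> x'" "y \<le> y'"
    show "?t (x, y) \<le> ?t (x', y')"
      using monotone_fillingD[OF t(1) a] above[of x' y'] a by auto
  qed
  moreover have "D' = diagonal_shift ?t ` M"
    unfolding diagonal_shift_update_image[OF t(1) pq(1)] ij(4) t(2)[symmetric] pq(2)[symmetric]
    by (simp add: i j ac_simps)
  ultimately show ?case by blast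
qed

text \<open>Induction on the sum of the values: the last move is undone at a box with positive value
  that is nearest to the origin. All boxes of \<open>M\<close> northwest of it have value 0, so
  lowering its value keeps the filling monotone.\<close>

lemma filling_imp_excited_moves:
  assumes "young M" "monotone_filling M t"
  shows "excited_move\<^sup>*\<^sup>* M (diagonal_shift t ` M)"
  using assms(2)
proof (induction "sum t M" arbitrary: t rule: less_induct)
  case less
  show ?case
  proof (cases "\<exists>c\<in>M. 0 < t c")
    case False
    then have "diagonal_shift t ` M = id ` M"
      by (intro image_cong) (auto simp: diagonal_shift_def)
    then show ?thesis by simp
  next
    case True
    then obtain a where a: "a \<in> M \<and> 0 < t a"
        "\<And>c. c \<in> M \<and> 0 < t c \<Longrightarrow> nat (fst a + snd a) \<le> nat (fst c + snd c)"
      using ex_has_least_nat[of "\<lambda>c. c \<in> M \<and> 0 < t c" _ "\<lambda>c. nat (fst c + snd c)"] by blast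
    obtain p q where pq: "a = (p, q)" by force
    have pos: "1 \<le> p" "1 \<le> q" using young_pos[OF assms(1), of p q] a(1) pq by auto
    have min: "p + q \<le> x + y" if "(x, y) \<in> M" "0 < t (x, y)" for x y
      using a(2)[of "(x, y)"] that pos pq by simp
    let ?T = "t (p, q)"
    let ?t = "t((p, q) := ?T - 1)"
    have T: "0 < ?T" "(p, q) \<in> M" using a(1) pq by auto
    have mono: "monotone_filling M ?t"
    proof (rule monotone_fillingI)
      fix x y x' y' assume a: "(x, y) \<in> M" "(x', y') \<in> M" "x \<le> x'" "y \<le> y'"
      have "(x', y') = (p, q) \<Longrightarrow> (x, y) \<noteq> (p, q) \<Longrightarrow> t (x, y) = 0"
        using min[OF a(1)] a(3,4) by fastforce
      then show "?t (x, y) \<le> ?t (x', y')"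
        using monotone_fillingD[OF less(2) a] by auto
    qed
    have "sum ?t M < sum t M"
      using T young_finite[OF assms(1)] by (intro sum_strict_mono_ex1) auto
    from less(1)[OF this mono] have moves: "excited_move\<^sup>*\<^sup>* M (diagonal_shift ?t ` M)" .
    define D where "D = diagonal_shift ?t ` M"
    define i j where "i = p + int ?T - 1" and "j = q + int ?T - 1"
    have s: "diagonal_shift ?t (p, q) = (i, j)"
      using T by (simp add: diagonal_shift_pair i_def j_def)
    \<comment> \<open>The last move is legal. A box landing on one of the three cells with value
      below \<open>?T\<close> would start southeast of \<open>(p, q)\<close>, against monotonicity;
      with value at least \<open>?T\<close> it would start northwest of \<open>(p, q)\<close>,
      against the minimal choice of \<open>(p, q)\<close>.\<close>
    have empty: "(i + e, j + f) \<notin> D" if "(e, f) = (1, 0) \<or> (e, f) = (0, 1) \<or> (e, f) = (1, 1)" for e f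
    proof
      assume "(i + e, j + f) \<in> D"
      then obtain x y where xy: "(x, y) \<in> M" "(i + e, j + f) = diagonal_shift ?t (x, y)"
        unfolding D_def by (rule diagonal_shift_imageE)
      have ne: "(x, y) \<noteq> (p, q)"
      proof
        assume "(x, y) = (p, q)"
        then have "(i + e, j + f) = (i, j)" using xy(2) s by simp
        then show False using that by simp
      qed
      then have "?t (x, y) = t (x, y)" by (rule fun_upd_other)
      then have u: "x = i + e - int (t (x, y))" "y = j + f - int (t (x, y))"
        using xy(2) unfolding diagonal_shift_pair by simp_all
      show False
      proof (cases "t (x, y) < ?T")
        case True
        then have "p \<le> x" "q \<le> y" using u that unfolding i_def j_def by auto
        then show False using monotone_fillingD[OF less(2) T(2) xy(1)] True by simp
      next
        case False
        then have "x \<le> p" "y \<le> q" using u that unfolding i_def j_def by auto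
        then show False using min[OF xy(1)] False T(1) ne by auto
      qed
    qed
    have "diagonal_shift t ` M = diagonal_shift (?t((p, q) := ?T)) ` M"
      by simp
    also have "\<dots> = insert (i + 1, j + 1) (D - {(i, j)})"
      unfolding diagonal_shift_update_image[OF mono T(2)] s D_def[symmetric]
      by (simp add: i_def j_def)
    finally have "diagonal_shift t ` M = (D - {(i, j)}) \<union> {(i + 1, j + 1)}" by simp
    moreover have "(i, j) \<in> D" using s T(2) unfolding D_def by force
    ultimately have "excited_move D (diagonal_shift t ` M)"
      unfolding excited_move_def
      using empty[of 1 0] empty[of 0 1] empty[of 1 1]
      by (intro exI[of _ i] exI[of _ j]) auto
    with moves show ?thesis unfolding D_def by (rule rtranclp.rtrancl_into_rtrancl)
  qed
qed

section \<open>Excited diagrams inside a fixed order ideal\<close>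

definition excitations_in :: "box set \<Rightarrow> box set \<Rightarrow> box set set" where
  "excitations_in S M = {E. excited_move\<^sup>*\<^sup>* M E \<and> E \<subseteq> S}"

lemma excitations_in_iff:
  assumes "young M"
  shows "E \<in> excitations_in S M \<longleftrightarrow>
    (\<exists>t. monotone_filling M t \<and> E = diagonal_shift t ` M \<and> E \<subseteq> S)"
  unfolding excitations_in_def
  using excited_moves_imp_filling[OF assms] filling_imp_excited_moves[OF assms] by blast

lemma excitations_inE:
  assumes "young M" "E \<in> excitations_in S M"
  obtains t where "monotone_filling M t" "E = diagonal_shift t ` M" "E \<subseteq> S"
  using assms(2) unfolding excitations_in_iff[OF assms(1)] by (elim exE conjE)

lemma excitations_inI:
  assumes "young M" "monotone_filling M t" "diagonal_shift t ` M \<subseteq> S"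
  shows "diagonal_shift t ` M \<in> excitations_in S M"
  unfolding excitations_in_iff[OF assms(1)] using assms(2,3) by (intro exI[of _ t] conjI refl)

lemma finite_excitations_in: "finite S \<Longrightarrow> finite (excitations_in S M)"
  by (rule finite_subset[of _ "Pow S"]) (auto simp: excitations_in_def)

text \<open>Boxes only move southeast, so each box of \<open>M\<close> lies northwest of its image
  in \<open>S\<close>. This makes the terms of the recursion with an added box outside
  \<open>S\<close> vanish.\<close>

lemma excitations_in_subset:
  assumes "young S" "young M" "excitations_in S M \<noteq> {}"
  shows "M \<subseteq> S"
proof
  fix c assume c: "c \<in> M"
  obtain E where "E \<in> excitations_in S M" using assms(3) by auto
  then obtain t where t: "diagonal_shift t ` M \<subseteq> S"
    by (metis excitations_inE[OF assms(2)])
  obtain i j where ij: "c = (i, j)" by force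
  have "(i + int (t (i, j)), j + int (t (i, j))) \<in> S"
    using diagonal_shift_mem[OF t] c ij by blast
  moreover have "1 \<le> i" "1 \<le> j" using young_pos[OF assms(2), of i j] c ij by auto
  ultimately show "c \<in> S"
    unfolding ij by (auto intro: young_down[OF assms(1)])
qed

text \<open>The shift is injective, so an excitation of \<open>S\<close> within \<open>S\<close> has
  as many boxes as \<open>S\<close>.\<close>

lemma excitations_in_self:
  assumes "young S"
  shows "excitations_in S S = {S}"
proof
  show "{S} \<subseteq> excitations_in S S" by (simp add: excitations_in_def)
  show "excitations_in S S \<subseteq> {S}"
  proof
    fix E assume "E \<in> excitations_in S S"
    then obtain t where t: "monotone_filling S t" "E = diagonal_shift t ` S" "E \<subseteq> S"
      by (rule excitations_inE[OF assms])
    then have "card E = card S" using card_image[OF inj_on_diagonal_shift] by blast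
    then show "E \<in> {S}" using card_subset_eq[OF young_finite[OF assms] t(3)] by simp
  qed
qed

text \<open>The box of \<open>M\<close> that reaches the corner \<open>b\<close> is itself a corner
  on the same diagonal, since a right or lower neighbour would move at least as far and leave
  \<open>S\<close>. Conversely, an excitation of \<open>M - {a}\<close> that avoids \<open>b\<close>
  extends by sending \<open>a\<close> to \<open>b\<close>; the work lies in showing that the
  extended filling is monotone.\<close>

lemma excitations_in_removable_mem:
  assumes "young S" "young M" "b \<in> removable S"
  shows "{E \<in> excitations_in S M. b \<in> E} =
    (\<Union>a\<in>removable_at M (content b). insert b ` excitations_in (S - {b}) (M - {a}))"
proof (intro set_eqI iffI)
  fix E assume E: "E \<in> {E \<in> excitations_in S M. b \<in> E}"
  then have "E \<in> excitations_in S M" and bE: "b \<in> E" by auto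
  then obtain t where t: "monotone_filling M t" "E = diagonal_shift t ` M" "E \<subseteq> S"
    using excitations_inE[OF assms(2)] by metis
  from bE obtain p q where pq: "(p, q) \<in> M" "b = diagonal_shift t (p, q)"
    unfolding t(2) by (rule diagonal_shift_imageE)
  define r s where "r = p + int (t (p, q))" and "s = q + int (t (p, q))"
  have b: "b = (r, s)" using pq(2) by (simp add: diagonal_shift_pair r_def s_def)
  have rs: "(r, s) \<in> S" "(r + 1, s) \<notin> S" "(r, s + 1) \<notin> S"
    using assms(3) removable_iff[OF assms(1)] b by auto
  have pos: "1 \<le> r" "1 \<le> s" using young_pos[OF assms(1) rs(1)] by auto
  have nbr: "(x, y) \<notin> M" if "(x, y) = (p + 1, q) \<or> (x, y) = (p, q + 1)" for x y
  proof
    assume xy: "(x, y) \<in> M"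
    then have S: "(x + int (t (x, y)), y + int (t (x, y))) \<in> S"
      using diagonal_shift_mem t(2,3) by blast
    have "t (p, q) \<le> t (x, y)"
      by (rule monotone_fillingD[OF t(1) pq(1) xy]) (use that in auto)
    then show False
      using young_down[OF assms(1) S, of "r + 1" s] young_down[OF assms(1) S, of r "s + 1"] that rs pos
      by (auto simp: r_def s_def)
  qed
  have rem: "(p, q) \<in> removable M"
    unfolding removable_iff[OF assms(2)] using pq(1) nbr by blast
  then have yM: "young (M - {(p, q)})" by (simp add: removable_def)
  have Eb: "E - {b} = diagonal_shift t ` (M - {(p, q)})"
    using inj_on_image_set_diff[OF inj_on_diagonal_shift[OF t(1)], of M "{(p, q)}"] pq t(2) by simp
  have "monotone_filling (M - {(p, q)}) t"
    by (rule monotone_fillingI) (use monotone_fillingD[OF t(1)] in blast)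
  then have "E - {b} \<in> excitations_in (S - {b}) (M - {(p, q)})"
    unfolding Eb using t(3) Eb by (intro excitations_inI[OF yM]) blast+
  moreover have "E = insert b (E - {b})" using bE by blast
  moreover have "(p, q) \<in> removable_at M (content b)"
    using rem b by (simp add: removable_at_def r_def s_def)
  ultimately show "E \<in> (\<Union>a\<in>removable_at M (content b). insert b ` excitations_in (S - {b}) (M - {a}))"
    by blast
next
  fix E assume "E \<in> (\<Union>a\<in>removable_at M (content b). insert b ` excitations_in (S - {b}) (M - {a}))"
  then obtain a E' where a: "a \<in> removable M" "content a = content b"
      and E: "E = insert b E'" "E' \<in> excitations_in (S - {b}) (M - {a})"
    unfolding removable_at_def by blast
  obtain p q r s where pq: "a = (p, q)" and b: "b = (r, s)" by force
  have yM: "young (M - {(p, q)})" and yS: "young (S - {(r, s)})"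
    using a(1) assms(3) pq b by (simp_all add: removable_def)
  from E(2) obtain t where t: "monotone_filling (M - {(p, q)}) t"
      "E' = diagonal_shift t ` (M - {(p, q)})" "E' \<subseteq> S - {(r, s)}"
    unfolding pq b by (rule excitations_inE[OF yM])
  have m: "(p, q) \<in> M" "(p + 1, q) \<notin> M" "(p, q + 1) \<notin> M"
    using a(1) removable_iff[OF assms(2)] pq by auto
  have rs: "(r, s) \<in> S" "(r + 1, s) \<notin> S" "(r, s + 1) \<notin> S"
    using assms(3) removable_iff[OF assms(1)] b by auto
  have pos: "1 \<le> p" "1 \<le> q" "1 \<le> r" "1 \<le> s"
    using young_pos[OF assms(2) m(1)] young_pos[OF assms(1) rs(1)] by auto
  \<comment> \<open>Otherwise \<open>b\<close> is a box of \<open>M\<close> before \<open>a\<close>.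
    Its image stays in the order ideal \<open>S - {b}\<close> and lies southeast of
    \<open>b\<close>, which would put \<open>b\<close> into that ideal.\<close>
  have pr: "p \<le> r"
  proof (rule ccontr)
    assume lt: "\<not> p \<le> r"
    then have "(r, s) \<in> M - {(p, q)}"
      using young_down[OF assms(2) m(1), of r s] a(2) pq b pos by auto
    then have "(r + int (t (r, s)), s + int (t (r, s))) \<in> S - {(r, s)}"
      using diagonal_shift_mem t(2,3) by blast
    from young_down[OF yS this, of r s] show False using pos by simp
  qed
  define e where "e = nat (r - p)"
  have re: "r = p + int e" "s = q + int e" using pr a(2) pq b by (auto simp: e_def)
  \<comment> \<open>A value above \<open>e\<close> northwest of \<open>a\<close> passes on to the
    upper or left neighbour of \<open>a\<close>, whose image then lies southeast of
    \<open>(r, s + 1)\<close> or \<open>(r + 1, s)\<close>, outside \<open>S\<close>.\<close>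
  have below: "t (x, y) \<le> e" if that0: "(x, y) \<in> M" "(x, y) \<noteq> (p, q)" "x \<le> p" "y \<le> q" for x y
  proof (rule ccontr)
    assume n: "\<not> t (x, y) \<le> e"
    have xy: "1 \<le> x" "1 \<le> y" using young_pos[OF assms(2) that0(1)] by auto
    have contra: False
      if n': "(x', y') = (p - 1, q) \<or> (x', y') = (p, q - 1)" "x \<le> x'" "y \<le> y'" for x' y'
    proof -
      have "1 \<le> x'" "x' \<le> p" "1 \<le> y'" "y' \<le> q" "(x', y') \<noteq> (p, q)"
        using n' xy by auto
      then have m': "(x', y') \<in> M - {(p, q)}"
        using young_down[OF assms(2) m(1), of x' y'] by simp
      have "(x, y) \<in> M - {(p, q)}" using that0 by simp
      then have "t (x, y) \<le> t (x', y')"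
        by (rule monotone_fillingD[OF t(1) _ m' n'(2,3)])
      then have "e < t (x', y')" using n by simp
      moreover have S: "(x' + int (t (x', y')), y' + int (t (x', y'))) \<in> S"
        using diagonal_shift_mem[of t "M - {(p, q)}" S] m' t(2,3) by blast
      ultimately show False
        using young_down[OF assms(1) S, of "r + 1" s] young_down[OF assms(1) S, of r "s + 1"] n'(1) rs pos
        unfolding re by auto
    qed
    show False
    proof (cases "x \<le> p - 1")
      case True
      then show False using contra[of "p - 1" q] that0(4) by simp
    next
      case False
      then have "x = p" "y \<noteq> q" using that0 by auto
      then show False using contra[of p "q - 1"] that0(4) by simp
    qed
  qed
  have above: "(x, y) = (p, q)" if "(x, y) \<in> M" "p \<le> x" "q \<le> y" for x y
    using young_down[OF assms(2) that(1), of "p + 1" q] young_down[OF assms(2) that(1), of p "q + 1"]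
      that m pos by (cases "x = p"; cases "y = q") auto
  let ?t = "t((p, q) := e)"
  have "monotone_filling M ?t"
  proof (rule monotone_fillingI)
    fix x y x' y' assume a: "(x, y) \<in> M" "(x', y') \<in> M" "x \<le> x'" "y \<le> y'"
    show "?t (x, y) \<le> ?t (x', y')"
      using monotone_fillingD[OF t(1), of x y x' y'] above[of x' y'] below[of x y] a
      by auto
  qed
  moreover have "diagonal_shift ?t ` M = insert b E'"
  proof -
    have "diagonal_shift ?t ` M = insert (diagonal_shift ?t (p, q)) (diagonal_shift ?t ` (M - {(p, q)}))"
      using m(1) by blast
    also have "diagonal_shift ?t ` (M - {(p, q)}) = E'"
      unfolding t(2) by (intro image_cong) (auto simp: diagonal_shift_def)
    also have "diagonal_shift ?t (p, q) = b" by (simp add: diagonal_shift_pair b re)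
    finally show ?thesis .
  qed
  moreover have "insert b E' \<subseteq> S" using t(3) rs(1) b by blast
  ultimately have "E \<in> excitations_in S M"
    using excitations_inI[OF assms(2), of ?t S] E(1) by simp
  then show "E \<in> {E \<in> excitations_in S M. b \<in> E}" using E(1) by simp
qed

section \<open>Hooks as differences of a potential\<close>

lemma int_initial_segment:
  fixes A :: "int set"
  assumes "finite A" "\<And>x. x \<in> A \<Longrightarrow> 1 \<le> x" "\<And>x y. x \<in> A \<Longrightarrow> 1 \<le> y \<Longrightarrow> y \<le> x \<Longrightarrow> y \<in> A"
  shows "A = {1..int (card A)}"
proof (cases "A = {}")
  case False
  have m: "Max A \<in> A" using assms(1) False by simp
  then have "1 \<le> Max A" by (rule assms(2))
  have "A = {1..Max A}"
  proof (intro set_eqI iffI)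
    fix x assume "x \<in> A"
    then show "x \<in> {1..Max A}" using assms(2) Max_ge[OF assms(1)] by simp
  next
    fix x assume "x \<in> {1..Max A}"
    then show "x \<in> A" using assms(3)[OF m] by simp
  qed
  moreover from this have "int (card A) = Max A"
    using \<open>1 \<le> Max A\<close> by (metis add_diff_cancel_left' card_atLeastAtMost_int diff_add_cancel
        int_nat_eq order_trans zero_le_one)
  ultimately show ?thesis by simp
qed simp

section \<open>Row and column lengths\<close>

definition row_length :: "box set \<Rightarrow> int \<Rightarrow> int" where
  "row_length S i = int (card {j. (i, j) \<in> S})"

definition col_length :: "box set \<Rightarrow> int \<Rightarrow> int" where
  "col_length S j = int (card {i. (i, j) \<in> S})"

lemma finite_row: "finite S \<Longrightarrow> finite {j. (i, j) \<in> (S :: box set)}"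
  by (rule finite_subset[of _ "snd ` S"]) force+

lemma finite_col: "finite S \<Longrightarrow> finite {i. (i, j) \<in> (S :: box set)}"
  by (rule finite_subset[of _ "fst ` S"]) force+

lemma row_iff:
  assumes "young S" "1 \<le> i"
  shows "(i, j) \<in> S \<longleftrightarrow> 1 \<le> j \<and> j \<le> row_length S i"
proof -
  have "{j. (i, j) \<in> S} = {1..row_length S i}"
    unfolding row_length_def
  proof (rule int_initial_segment)
    show "finite {j. (i, j) \<in> S}" by (intro finite_row young_finite assms)
  next
    fix x assume "x \<in> {j. (i, j) \<in> S}"
    then show "1 \<le> x" using young_pos[OF assms(1), of i x] by simp
  next
    fix x y assume "x \<in> {j. (i, j) \<in> S}" "1 \<le> y" "y \<le> x"
    then show "y \<in> {j. (i, j) \<in> S}" using young_down[OF assms(1), of i x i y] assms(2) by simp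
  qed
  then show ?thesis by (metis (mono_tags) atLeastAtMost_iff mem_Collect_eq)
qed

lemma col_iff:
  assumes "young S" "1 \<le> j"
  shows "(i, j) \<in> S \<longleftrightarrow> 1 \<le> i \<and> i \<le> col_length S j"
proof -
  have "{i. (i, j) \<in> S} = {1..col_length S j}"
    unfolding col_length_def
  proof (rule int_initial_segment)
    show "finite {i. (i, j) \<in> S}" by (intro finite_col young_finite assms)
  next
    fix x assume "x \<in> {i. (i, j) \<in> S}"
    then show "1 \<le> x" using young_pos[OF assms(1), of x j] by simp
  next
    fix x y assume "x \<in> {i. (i, j) \<in> S}" "1 \<le> y" "y \<le> x"
    then show "y \<in> {i. (i, j) \<in> S}" using young_down[OF assms(1), of x j y j] assms(2) by simp
  qed
  then show ?thesis by (metis (mono_tags) atLeastAtMost_iff mem_Collect_eq)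
qed

lemma row_length_remove:
  assumes "finite S" "(r, s) \<in> S"
  shows "row_length (S - {(r, s)}) i = row_length S i - (if i = r then 1 else 0)"
proof (cases "i = r")
  case True
  have "{j. (r, j) \<in> S - {(r, s)}} = {j. (r, j) \<in> S} - {s}" by auto
  moreover have "0 < card {j. (r, j) \<in> S}"
    using finite_row[OF assms(1)] assms(2) by (auto simp: card_gt_0_iff)
  ultimately show ?thesis
    using True assms(2) by (simp add: row_length_def card_Diff_singleton)
next
  case False
  then have "{j. (i, j) \<in> S - {(r, s)}} = {j. (i, j) \<in> S}" by auto
  then show ?thesis using False by (simp add: row_length_def)
qed

lemma col_length_remove:
  assumes "finite S" "(r, s) \<in> S"
  shows "col_length (S - {(r, s)}) j = col_length S j - (if j = s then 1 else 0)"
proof (cases "j = s")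
  case True
  have "{i. (i, s) \<in> S - {(r, s)}} = {i. (i, s) \<in> S} - {r}" by auto
  moreover have "0 < card {i. (i, s) \<in> S}"
    using finite_col[OF assms(1)] assms(2) by (auto simp: card_gt_0_iff)
  ultimately show ?thesis
    using True assms(2) by (simp add: col_length_def card_Diff_singleton)
next
  case False
  then have "{i. (i, j) \<in> S - {(r, s)}} = {i. (i, j) \<in> S}" by auto
  then show ?thesis using False by (simp add: col_length_def)
qed

text \<open>
  For a box of \<open>S\<close> the two arguments of \<open>w\<close> are the content of the last box of its row and one less
  than the content of the last box of its column.
\<close>
definition hook_potential :: "(int \<Rightarrow> 'a::comm_ring_1) \<Rightarrow> box set \<Rightarrow> box \<Rightarrow> 'a" where
  "hook_potential w S c = w (row_length S (fst c) - fst c) - w (snd c - 1 - col_length S (snd c))"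

text \<open>\<open>w\<close> composed with the transposition of \<open>k - 1\<close> and
  \<open>k\<close>. On the differences \<open>z m = w m - w (m - 1)\<close> it is a simple
  reflection: \<open>z k\<close> changes sign and is added to \<open>z (k - 1)\<close> and
  \<open>z (k + 1)\<close>.\<close>

definition swap_at :: "int \<Rightarrow> (int \<Rightarrow> 'a) \<Rightarrow> int \<Rightarrow> 'a" where
  "swap_at k w m = (if m = k then w (k - 1) else if m = k - 1 then w k else w m)"

lemma removable_row_length:
  assumes "young S" "(r, s) \<in> removable S"
  shows "row_length S r = s"
proof -
  have b: "(r, s) \<in> S" "(r, s + 1) \<notin> S" using assms removable_iff by auto
  moreover have "1 \<le> r" "1 \<le> s" using young_pos[OF assms(1) b(1)] by auto
  ultimately show ?thesis
    using row_iff[OF assms(1), of r s] row_iff[OF assms(1), of r "s + 1"] by linarith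
qed

lemma removable_col_length:
  assumes "young S" "(r, s) \<in> removable S"
  shows "col_length S s = r"
proof -
  have b: "(r, s) \<in> S" "(r + 1, s) \<notin> S" using assms removable_iff by auto
  moreover have "1 \<le> r" "1 \<le> s" using young_pos[OF assms(1) b(1)] by auto
  ultimately show ?thesis
    using col_iff[OF assms(1), of s r] col_iff[OF assms(1), of s "r + 1"] by linarith
qed

lemma hook_potential_corner:
  assumes "young S" "b \<in> removable S"
  shows "hook_potential w S b = w (content b) - w (content b - 1)"
proof -
  obtain r s where b: "b = (r, s)" by force
  show ?thesis
    using removable_row_length[OF assms(1), of r s] removable_col_length[OF assms(1), of r s] assms(2)
    by (simp add: b hook_potential_def algebra_simps)
qed

text \<open>With \<open>k\<close> the content of \<open>b\<close>, removal turns the argument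
  \<open>k\<close> of the row of \<open>b\<close> into \<open>k - 1\<close> and the argument
  \<open>k - 1\<close> of its column into \<open>k\<close>. Longer rows and columns and shorter ones
  have arguments different from both, so the transposition compensates exactly.\<close>

lemma hook_potential_remove:
  assumes "young S" "b \<in> removable S" "c \<in> S - {b}"
  shows "hook_potential (swap_at (content b) w) (S - {b}) c = hook_potential w S c"
proof -
  obtain r s i j where b: "b = (r, s)" and c: "c = (i, j)" by force
  have rs: "(r, s) \<in> removable S" using assms(2) b by simp
  then have m: "(r, s) \<in> S" "(r + 1, s) \<notin> S" "(r, s + 1) \<notin> S"
    unfolding removable_iff[OF assms(1)] by auto
  have ij: "(i, j) \<in> S" using assms(3) c by simp
  have pos: "1 \<le> r" "1 \<le> s" "1 \<le> i" "1 \<le> j"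
    using young_pos[OF assms(1) m(1)] young_pos[OF assms(1) ij] by auto
  have row: "swap_at (s - r) w (row_length (S - {(r, s)}) i - i) = w (row_length S i - i)"
  proof -
    consider "i = r" | "i < r" | "r < i" by linarith
    then show ?thesis
    proof cases
      case 1
      then show ?thesis
        using removable_row_length[OF assms(1) rs] row_length_remove[OF young_finite[OF assms(1)] m(1), of i]
        by (simp add: swap_at_def)
    next
      case 2
      have "(i, s) \<in> S" using young_down[OF assms(1) m(1), of i s] 2 pos by simp
      then have "s \<le> row_length S i" using row_iff[OF assms(1) pos(3)] by blast
      then show ?thesis
        using row_length_remove[OF young_finite[OF assms(1)] m(1), of i] 2 by (simp add: swap_at_def)
    next
      case 3
      have "(i, s) \<notin> S" using young_down[OF assms(1), of i s "r + 1" s] m(2) 3 pos by auto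
      then have "row_length S i < s" using row_iff[OF assms(1) pos(3), of s] pos by simp
      then show ?thesis
        using row_length_remove[OF young_finite[OF assms(1)] m(1), of i] 3 by (simp add: swap_at_def)
    qed
  qed
  have col: "swap_at (s - r) w (j - 1 - col_length (S - {(r, s)}) j) = w (j - 1 - col_length S j)"
  proof -
    consider "j = s" | "j < s" | "s < j" by linarith
    then show ?thesis
    proof cases
      case 1
      then show ?thesis
        using removable_col_length[OF assms(1) rs] col_length_remove[OF young_finite[OF assms(1)] m(1), of j]
        by (simp add: swap_at_def algebra_simps)
    next
      case 2
      have "(r, j) \<in> S" using young_down[OF assms(1) m(1), of r j] 2 pos by simp
      then have "r \<le> col_length S j" using col_iff[OF assms(1) pos(4)] by blast
      then show ?thesis
        using col_length_remove[OF young_finite[OF assms(1)] m(1), of j] 2 by (simp add: swap_at_def)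
    next
      case 3
      have "(r, j) \<notin> S" using young_down[OF assms(1), of r j r "s + 1"] m(3) 3 pos by auto
      then have "col_length S j < r" using col_iff[OF assms(1) pos(4), of r] pos by simp
      then show ?thesis
        using col_length_remove[OF young_finite[OF assms(1)] m(1), of j] 3 by (simp add: swap_at_def)
    qed
  qed
  show ?thesis using row col by (simp add: hook_potential_def b c)
qed

section \<open>The sum over excited diagrams under removal of a corner\<close>

definition excitation_sum :: "(int \<Rightarrow> 'a::comm_ring_1) \<Rightarrow> box set \<Rightarrow> box set \<Rightarrow> 'a" where
  "excitation_sum w S M = (\<Sum>E\<in>excitations_in S M. \<Prod>c\<in>E. hook_potential w S c)"

definition content_weight :: "(int \<Rightarrow> 'a::comm_ring_1) \<Rightarrow> box set \<Rightarrow> 'a" where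
  "content_weight w M = (\<Sum>c\<in>M. w (content c) - w (content c - 1))"

lemma removable_at_cases:
  assumes "young M"
  obtains "removable_at M k = {}" | a where "removable_at M k = {a}" "a \<in> removable M" "content a = k"
proof (cases "removable_at M k = {}")
  case False
  then obtain a where a: "a \<in> removable M" "content a = k" by (auto simp: removable_at_def)
  have "x = a" if "x \<in> removable_at M k" for x
    by (rule removable_unique[OF assms]) (use that a in \<open>simp_all add: removable_at_def\<close>)
  moreover have "a \<in> removable_at M k" using a by (simp add: removable_at_def)
  ultimately have "removable_at M k = {a}" by blast
  then show ?thesis using a by (rule that(2))
qed (rule that(1))

text \<open>Split the excited diagrams by whether they contain \<open>b\<close>. Those that avoid it
  are the excitations inside \<open>S - {b}\<close>; the others contribute the hook of
  \<open>b\<close>, which is a single box, as a factor. The sum over \<open>removable_at\<close> has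
  at most one term and covers both cases of the recursion.\<close>

lemma excitation_sum_remove:
  assumes "young S" "young M" "b \<in> removable S"
  shows "excitation_sum w S M =
    excitation_sum (swap_at (content b) w) (S - {b}) M +
    (w (content b) - w (content b - 1)) *
      (\<Sum>a\<in>removable_at M (content b). excitation_sum (swap_at (content b) w) (S - {b}) (M - {a}))"
proof -
  let ?w = "swap_at (content b) w" and ?S = "S - {b}"
  have fin: "finite (excitations_in S M)"
    by (intro finite_excitations_in young_finite assms)
  have prod: "(\<Prod>c\<in>E. hook_potential w S c) = (\<Prod>c\<in>E. hook_potential ?w ?S c)" if "E \<subseteq> ?S" for E
    by (intro prod.cong refl hook_potential_remove[OF assms(1,3), symmetric] subsetD[OF that])
  have out: "{E \<in> excitations_in S M. b \<notin> E} = excitations_in ?S M"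
    unfolding excitations_in_def by auto
  have "excitation_sum w S M = (\<Sum>E\<in>{E \<in> excitations_in S M. b \<notin> E}. \<Prod>c\<in>E. hook_potential w S c) +
      (\<Sum>E\<in>{E \<in> excitations_in S M. b \<in> E}. \<Prod>c\<in>E. hook_potential w S c)"
    unfolding excitation_sum_def
    by (subst sum.union_disjoint[symmetric]) (use fin in \<open>auto intro!: sum.cong\<close>)
  also have "(\<Sum>E\<in>{E \<in> excitations_in S M. b \<notin> E}. \<Prod>c\<in>E. hook_potential w S c) =
      excitation_sum ?w ?S M"
    unfolding out excitation_sum_def
    by (intro sum.cong prod refl) (simp add: excitations_in_def)
  also have "(\<Sum>E\<in>{E \<in> excitations_in S M. b \<in> E}. \<Prod>c\<in>E. hook_potential w S c) =
      (w (content b) - w (content b - 1)) *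
      (\<Sum>a\<in>removable_at M (content b). excitation_sum ?w ?S (M - {a}))"
  proof (cases rule: removable_at_cases[OF assms(2), of "content b"])
    case (2 a)
    have sub: "E \<subseteq> ?S" if "E \<in> excitations_in ?S (M - {a})" for E
      using that by (simp add: excitations_in_def)
    \<comment> \<open>No excitation inside \<open>S - {b}\<close> contains \<open>b\<close>, so
      inserting it can be undone.\<close>
    have "inj_on (insert b) (excitations_in ?S (M - {a}))"
      by (intro inj_onI) (use sub in \<open>blast dest: insert_ident[THEN iffD1, rotated 2]\<close>)
    then have "(\<Sum>E\<in>insert b ` excitations_in ?S (M - {a}). \<Prod>c\<in>E. hook_potential w S c) =
        (\<Sum>E\<in>excitations_in ?S (M - {a}). \<Prod>c\<in>insert b E. hook_potential w S c)"
      by (rule sum.reindex_cong) simp_all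
    also have "\<dots> = (\<Sum>E\<in>excitations_in ?S (M - {a}).
        hook_potential w S b * (\<Prod>c\<in>E. hook_potential ?w ?S c))"
    proof (rule sum.cong[OF refl])
      fix E assume "E \<in> excitations_in ?S (M - {a})"
      note s = sub[OF this]
      then have "finite E" "b \<notin> E"
        using finite_subset young_finite[OF assms(1)] by blast+
      then show "(\<Prod>c\<in>insert b E. hook_potential w S c) =
          hook_potential w S b * (\<Prod>c\<in>E. hook_potential ?w ?S c)"
        using prod[OF s] by simp
    qed
    finally show ?thesis
      using 2(1) hook_potential_corner[OF assms(1,3), of w]
      by (simp add: excitation_sum_def sum_distrib_left excitations_in_removable_mem[OF assms])
  qed (simp add: excitations_in_removable_mem[OF assms])
  finally show ?thesis .
qed

section \<open>The Pieri-type recursion\<close>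

text \<open>The addable box lies beyond the removable one on their diagonal, so its upper neighbour
  is a box of \<open>M\<close> that dominates the right neighbour of the removable box.\<close>

lemma addable_removable_exclusive:
  assumes "young M" "a \<in> addable M" "b \<in> removable M"
  shows "content a \<noteq> content b"
proof
  assume eq: "content a = content b"
  obtain i j x y where ij: "a = (i, j)" and xy: "b = (x, y)" by force
  have a: "(i, j) \<notin> M" "i = 1 \<or> (i - 1, j) \<in> M"
    using assms(2) addable_iff[OF assms(1)] ij by auto
  have b: "(x, y) \<in> M" "(x, y + 1) \<notin> M"
    using assms(3) removable_iff[OF assms(1)] xy by auto
  have ap: "1 \<le> i" "1 \<le> j"
    using assms(2) addable_iff[OF assms(1)] ij by auto
  have bp: "1 \<le> x" "1 \<le> y" using young_pos[OF assms(1) b(1)] by auto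
  have "x < i"
    using young_down[OF assms(1) b(1), of i j] a(1) ap eq ij xy by force
  moreover from this have "(i - 1, j) \<in> M" using a(2) bp by auto
  ultimately show False
    using young_down[OF assms(1), of "i - 1" j x "y + 1"] b(2) bp eq ij xy by auto
qed

lemma removable_at_addable:
  assumes "young M" "a \<in> addable M"
  shows "removable_at M (content a) = {}"
  using addable_removable_exclusive[OF assms] unfolding removable_at_def
  by (metis (mono_tags, lifting) empty_Collect_eq)

lemma addable_at_content: "a \<in> addable M \<Longrightarrow> addable_at M (content a) \<noteq> {}"
  unfolding addable_at_def by blast

lemma young_addable: "a \<in> addable M \<Longrightarrow> young (insert a M)"
  by (simp add: addable_def)

lemma young_removable: "a \<in> removable M \<Longrightarrow> young (M - {a})"
  by (simp add: removable_def)

lemma exists_removable: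
  assumes "young S" "S \<noteq> {}"
  shows "removable S \<noteq> {}"
proof -
  let ?g = "\<lambda>x :: box. fst x + snd x"
  have fin: "finite (?g ` S)" using young_finite[OF assms(1)] by simp
  then have "Max (?g ` S) \<in> ?g ` S" using assms(2) by (intro Max_in) auto
  then obtain c where c: "c \<in> S" "?g c = Max (?g ` S)" by force
  have max: "?g x \<le> ?g c" if "x \<in> S" for x
    unfolding c(2) using that fin by simp
  obtain i j where ij: "c = (i, j)" by force
  have "(i, j) \<in> removable S"
    unfolding removable_iff[OF assms(1)] using c(1) max[of "(i + 1, j)"] max[of "(i, j + 1)"] ij by auto
  then show ?thesis by blast
qed

lemma removable_insert_same:
  assumes "young M" "c \<in> addable M"
  shows "removable_at (insert c M) (content c) = {c}"
proof -
  have "insert c M - {c} = M" using assms(2) by (auto simp: addable_def)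
  then have c: "c \<in> removable (insert c M)" using assms(1) by (simp add: removable_def)
  have "x = c" if "x \<in> removable_at (insert c M) (content c)" for x
    by (rule removable_unique[OF young_addable[OF assms(2)]])
      (use that c in \<open>simp_all add: removable_at_def\<close>)
  then show ?thesis using c by (auto simp: removable_at_def)
qed

text \<open>A corner that survives the addition of a box was a corner before, by intersecting order
  ideals.\<close>

lemma removable_insert_other:
  assumes "young M" "content c \<noteq> k"
  shows "removable_at (insert c M) k \<subseteq> removable_at M k"
proof
  fix x assume x: "x \<in> removable_at (insert c M) k"
  then have "x \<noteq> c" "x \<in> M" "young (insert c M - {x})" "content x = k"
    using assms(2) by (auto simp: removable_at_def removable_def)
  moreover have "M - {x} = (insert c M - {x}) \<inter> M" by blast
  ultimately show "x \<in> removable_at M k"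
    using young_Int[OF _ assms(1), of "insert c M - {x}"] by (simp add: removable_at_def removable_def)
qed

lemma sum_diagonal_indicator:
  "finite M \<Longrightarrow> (\<Sum>c\<in>M. if content c = k then z else 0) = of_int (diagonal_count M k) * (z :: 'a::comm_ring_1)"
  by (simp add: sum.inter_filter[symmetric] diagonal_count_def)

text \<open>The reflection adds \<open>w k - w (k - 1)\<close> on diagonals \<open>k - 1\<close> and
  \<open>k + 1\<close> and subtracts it twice on diagonal \<open>k\<close>, so the total changes by
  a second difference of diagonal lengths.\<close>

lemma content_weight_swap:
  assumes "young M"
  shows "content_weight (swap_at k w) M = content_weight w M + (w k - w (k - 1)) *
    ((if addable_at M k = {} then 0 else 1) - (if removable_at M k = {} then 0 else 1) -
     (if k = 0 then 1 else 0))"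
proof -
  let ?z = "w k - w (k - 1)"
  let ?d = "\<lambda>m. if m = k - 1 then ?z else 0" and ?e = "\<lambda>m. if m = k + 1 then ?z else 0"
    and ?f = "\<lambda>m. if m = k then ?z else 0"
  have s: "swap_at k w m - swap_at k w (m - 1) = (w m - w (m - 1)) + (?d m + ?e m - 2 * ?f m)" for m
  proof -
    consider "m = k" | "m = k + 1" | "m = k - 1" | "m \<noteq> k" "m \<noteq> k + 1" "m \<noteq> k - 1" by blast
    then show ?thesis by cases (simp_all add: swap_at_def)
  qed
  have "content_weight (swap_at k w) M = content_weight w M +
      ((\<Sum>c\<in>M. ?d (content c)) + (\<Sum>c\<in>M. ?e (content c)) - 2 * (\<Sum>c\<in>M. ?f (content c)))"
    unfolding content_weight_def s by (simp only: sum.distrib sum_subtractf sum_distrib_left)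
  also have "(\<Sum>c\<in>M. ?d (content c)) + (\<Sum>c\<in>M. ?e (content c)) - 2 * (\<Sum>c\<in>M. ?f (content c)) =
      ?z * of_int (diagonal_count M (k - 1) + diagonal_count M (k + 1) - 2 * diagonal_count M k)"
    unfolding sum_diagonal_indicator[OF young_finite[OF assms]] by (simp add: algebra_simps)
  also have "diagonal_count M (k - 1) + diagonal_count M (k + 1) - 2 * diagonal_count M k =
      (if addable_at M k = {} then 0 else 1) - (if removable_at M k = {} then 0 else 1) -
       (if k = 0 then 1 else 0)"
    using second_difference_diagonal_count[OF assms, of k] by linarith
  finally show ?thesis by simp
qed

text \<open>Adding a box and removing a box of content \<open>k\<close> commute, except when both
  steps concern the same box. Adding and then removing it gives \<open>f M\<close>; removing and
  then adding it back is excluded on the right by \<open>- {a}\<close>.\<close>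

lemma sum_addable_removable:
  assumes "young M"
  shows "(\<Sum>c\<in>addable M. \<Sum>a\<in>removable_at (insert c M) k. f (insert c M - {a})) =
    (if addable_at M k = {} then 0 else f M) +
    (\<Sum>a\<in>removable_at M k. \<Sum>c\<in>addable (M - {a}) - {a}. f (insert c (M - {a})))"
    (is "?l = ?r")
proof (cases "addable_at M k = {}")
  case False
  then obtain a where a: "a \<in> addable M" "content a = k" by (auto simp: addable_at_def)
  have e: "removable_at M k = {}"
    using removable_at_addable[OF assms a(1)] a(2) by simp
  have "removable_at (insert c M) k = {}" if "c \<in> addable M - {a}" for c
  proof -
    have "content c \<noteq> k" using addable_unique[OF assms, of c a] a that by auto
    then show ?thesis using removable_insert_other[OF assms] e by blast
  qed
  then have "(\<Sum>c\<in>addable M - {a}. \<Sum>a\<in>removable_at (insert c M) k. f (insert c M - {a})) = 0"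
    by simp
  moreover have "removable_at (insert a M) k = {a}"
    using removable_insert_same[OF assms a(1)] a(2) by simp
  moreover have "insert a M - {a} = M" using a(1) by (auto simp: addable_def)
  ultimately have "?l = f M"
    using sum.remove[OF finite_addable[OF assms] a(1),
        of "\<lambda>c. \<Sum>a\<in>removable_at (insert c M) k. f (insert c M - {a})"] by simp
  then show ?thesis using False e by simp
next
  case True
  then have ne: "content c \<noteq> k" if "c \<in> addable M" for c
    using that unfolding addable_at_def by blast
  have sub: "removable_at (insert c M) k \<subseteq> removable_at M k" if "c \<in> addable M" for c
    by (rule removable_insert_other[OF assms ne[OF that]])
  show ?thesis
  proof (cases rule: removable_at_cases[OF assms, of k])
    case 1
    then have "removable_at (insert c M) k = {}" if "c \<in> addable M" for c
      using sub[OF that] by simp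
    then show ?thesis using 1 True by simp
  next
    case (2 a)
    \<comment> \<open>For \<open>c\<close> other than \<open>a\<close>, adding \<open>c\<close> to
      \<open>M - {a}\<close> and uniting with \<open>M\<close> gives an order ideal again.\<close>
    have inter: "addable M \<inter> addable (M - {a}) = addable (M - {a}) - {a}"
    proof (intro set_eqI iffI)
      fix c assume c: "c \<in> addable M \<inter> addable (M - {a})"
      then have "c \<noteq> a" using 2(2) by (auto simp: addable_def removable_def)
      then show "c \<in> addable (M - {a}) - {a}" using c by simp
    next
      fix c assume c: "c \<in> addable (M - {a}) - {a}"
      then have n: "c \<notin> M" and y: "young (insert c (M - {a}))" by (auto simp: addable_def)
      have "insert c M = insert c (M - {a}) \<union> M" by blast
      then have "young (insert c M)" using young_Un[OF y assms] by simp
      then show "c \<in> addable M \<inter> addable (M - {a})" using n c by (simp add: addable_def)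
    qed
    have rem: "removable_at (insert c M) k = (if c \<in> addable (M - {a}) then {a} else {})"
      if c: "c \<in> addable M" for c
    proof -
      have "a \<in> M" "c \<notin> M" using 2(2) c by (auto simp: addable_def removable_def)
      then have "insert c M - {a} = insert c (M - {a})" by blast
      then have "a \<in> removable_at (insert c M) k \<longleftrightarrow> c \<in> addable (M - {a})"
        using 2 \<open>a \<in> M\<close> \<open>c \<notin> M\<close> by (simp add: removable_at_def removable_def addable_def)
      then show ?thesis using sub[OF c] 2(1) by auto
    qed
    have "?l = (\<Sum>c\<in>addable M. if c \<in> addable (M - {a}) then f (insert c M - {a}) else 0)"
      by (intro sum.cong refl) (simp add: rem)
    also have "\<dots> = (\<Sum>c\<in>addable M \<inter> addable (M - {a}). f (insert c M - {a}))"
      by (rule sum.inter_restrict[OF finite_addable[OF assms], symmetric])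
    also have "\<dots> = (\<Sum>c\<in>addable (M - {a}) - {a}. f (insert c (M - {a})))"
      unfolding inter
    proof (rule sum.cong[OF refl])
      fix c assume "c \<in> addable (M - {a}) - {a}"
      then have "insert c M - {a} = insert c (M - {a})" by blast
      then show "f (insert c M - {a}) = f (insert c (M - {a}))" by simp
    qed
    finally show ?thesis using 2(1) True by simp
  qed
qed

text \<open>The induction must let \<open>w\<close> vary, because removing a corner of
  \<open>S\<close> replaces \<open>w\<close> by its transposed version.\<close>

lemma excitation_sum_recursion:
  assumes "young S" "young M"
  shows "(content_weight w S - content_weight w M) * excitation_sum w S M =
    (\<Sum>a\<in>addable M. excitation_sum w S (insert a M))"
  using assms
proof (induction "card S" arbitrary: S M w)
  case 0
  then have S: "S = {}" using young_finite by auto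
  have ne: "excitations_in S N = {}" if "N \<noteq> {}" "young N" for N
    using excitations_in_subset[of S N] S that by auto
  \<comment> \<open>For empty \<open>S\<close> only the empty \<open>M\<close> has an excitation,
    and then both total weights are 0.\<close>
  have "content_weight w S - content_weight w M = 0 \<or> excitation_sum w S M = 0"
    using ne[of M] 0 S by (cases "M = {}") (auto simp: excitation_sum_def)
  moreover have "excitation_sum w S (insert a M) = 0" if "a \<in> addable M" for a
    using ne[OF _ young_addable[OF that]] by (simp add: excitation_sum_def)
  ultimately show ?case by auto
next
  case (Suc n)
  then obtain b where b: "b \<in> removable S"
    using exists_removable[of S] by fastforce
  define k where "k = content b"
  define z where "z = w k - w (k - 1)"
  define T where "T = S - {b}"
  define f where "f = excitation_sum (swap_at k w) T"
  define A where "A N = (if addable_at N k = {} then 0 else 1 :: 'a)" for N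
  define R where "R N = (if removable_at N k = {} then 0 else 1 :: 'a)" for N
  have bS: "b \<in> S" using b by (simp add: removable_def)
  have T: "young T" "card T = n"
    using b bS Suc(2) young_finite[OF Suc(3)] by (simp_all add: T_def removable_def)
  have bT: "b \<in> addable T"
    using bS Suc(3) by (simp add: T_def addable_def insert_absorb)
  have AT: "A T = 1" using addable_at_content[OF bT] by (simp add: A_def k_def)
  have RT: "R T = 0"
    using removable_at_addable[OF T(1) bT] by (simp add: R_def k_def)
  have cS: "content_weight w S = content_weight w T + z"
    unfolding content_weight_def T_def z_def k_def
    using sum.remove[OF young_finite[OF Suc(3)] bS, of "\<lambda>c. w (content c) - w (content c - 1)"]
    by simp
  have swap: "content_weight (swap_at k w) N =
      content_weight w N + z * (A N - R N - (if k = 0 then 1 else 0))" if "young N" for N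
    unfolding z_def A_def R_def by (rule content_weight_swap[OF that])
  \<comment> \<open>The corner \<open>b\<close> is addable to \<open>T\<close>, so the reflection
    raises the weight of \<open>T\<close> to that of \<open>S\<close>, up to the correction at
    \<open>k = 0\<close>; this correction is the same for \<open>N\<close> and cancels in the
    difference.\<close>
  have IH: "(content_weight w S - content_weight w N - z * (A N - R N)) * f N =
      (\<Sum>a\<in>addable N. f (insert a N))" if "young N" for N
  proof -
    have "content_weight (swap_at k w) T - content_weight (swap_at k w) N =
        content_weight w S - content_weight w N - z * (A N - R N)"
      unfolding swap[OF that] swap[OF T(1)] cS AT RT by (simp add: algebra_simps)
    then show ?thesis
      using Suc(1)[OF T(2)[symmetric] T(1) that, of "swap_at k w"] by (simp add: f_def)
  qed
  have split: "excitation_sum w S N = f N + z * (\<Sum>a\<in>removable_at N k. f (N - {a}))"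
    if "young N" for N
    unfolding f_def z_def k_def T_def by (rule excitation_sum_remove[OF Suc(3) that b])
  let ?X = "\<Sum>a\<in>removable_at M k. \<Sum>c\<in>addable (M - {a}) - {a}. f (insert c (M - {a}))"
  have "(\<Sum>a\<in>addable M. excitation_sum w S (insert a M)) =
      (\<Sum>a\<in>addable M. f (insert a M)) +
      z * (\<Sum>c\<in>addable M. \<Sum>a\<in>removable_at (insert c M) k. f (insert c M - {a}))"
    unfolding sum_distrib_left[of z] sum.distrib[symmetric]
    by (intro sum.cong refl) (simp add: split[OF young_addable] sum_distrib_left)
  also have "\<dots> = (content_weight w S - content_weight w M - z * (A M - R M)) * f M +
      z * (A M * f M + ?X)"
    unfolding IH[OF Suc(4)] sum_addable_removable[OF Suc(4)] by (simp add: A_def)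
  \<comment> \<open>If \<open>M\<close> has a corner \<open>a\<close> of content \<open>k\<close>,
    apply the induction hypothesis to \<open>M - {a}\<close>: the terms in \<open>z\<close> turn its
    factor into the one for \<open>M\<close>, and the summand that adds \<open>a\<close> back is the
    separated \<open>f M\<close>.\<close>
  also have "?X = (content_weight w S - content_weight w M) * (\<Sum>a\<in>removable_at M k. f (M - {a})) - R M * f M"
  proof (cases rule: removable_at_cases[OF Suc(4), of k])
    case 1
    then show ?thesis by (simp add: R_def)
  next
    case (2 a)
    let ?N = "M - {a}"
    have aM: "a \<in> M" using 2(2) by (simp add: removable_def)
    then have ins: "insert a ?N = M" by blast
    have N: "young ?N" by (rule young_removable[OF 2(2)])
    have aN: "a \<in> addable ?N" using ins Suc(4) by (simp add: addable_def)
    have AN: "A ?N = 1" using addable_at_content[OF aN] 2(3) by (simp add: A_def)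
    have RN: "R ?N = 0"
      using removable_at_addable[OF N aN] 2(3) by (simp add: R_def)
    have cM: "content_weight w M = content_weight w ?N + z"
      unfolding content_weight_def z_def 2(3)[symmetric]
      using sum.remove[OF young_finite[OF Suc(4)] aM, of "\<lambda>c. w (content c) - w (content c - 1)"]
      by simp
    have "(content_weight w S - content_weight w M) * f ?N = (\<Sum>c\<in>addable ?N. f (insert c ?N))"
      unfolding IH[OF N, symmetric] AN RN cM by (simp add: algebra_simps)
    also have "\<dots> = f M + (\<Sum>c\<in>addable ?N - {a}. f (insert c ?N))"
      using sum.remove[OF finite_addable[OF N] aN, of "\<lambda>c. f (insert c ?N)"] ins by simp
    finally show ?thesis using 2(1) by (simp add: R_def)
  qed
  \<comment> \<open>The terms with \<open>A M\<close> and \<open>R M\<close> cancel, and what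
    remains is the common factor times the splitting of \<open>excitation_sum w S M\<close>.\<close>
  also have "(content_weight w S - content_weight w M - z * (A M - R M)) * f M + z * (A M * f M +
        ((content_weight w S - content_weight w M) * (\<Sum>a\<in>removable_at M k. f (M - {a})) - R M * f M)) =
      (content_weight w S - content_weight w M) * excitation_sum w S M"
    unfolding split[OF Suc(4)] by (simp add: algebra_simps)
  finally show ?case by simp
qed

section \<open>Removing the entry 1 from a standard tableau\<close>

definition standard_fillings :: "box set \<Rightarrow> (box \<Rightarrow> nat) set" where
  "standard_fillings Y = {T \<in> extensional Y. bij_betw T Y {1..card Y} \<and>
     (\<forall>i j. (i, j) \<in> Y \<and> (i, j + 1) \<in> Y \<longrightarrow> T (i, j) < T (i, j + 1)) \<and>
     (\<forall>i j. (i, j) \<in> Y \<and> (i + 1, j) \<in> Y \<longrightarrow> T (i, j) < T (i + 1, j))}"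

text \<open>The partial sums are indexed by boxes with entry at least \<open>k\<close> rather than
  by entries, which avoids the inverse of \<open>T\<close>.\<close>

definition filling_weight :: "(int \<Rightarrow> 'a::field) \<Rightarrow> box set \<Rightarrow> (box \<Rightarrow> nat) \<Rightarrow> 'a" where
  "filling_weight z Y T = 1 / (\<Prod>k=1..card Y. \<Sum>c\<in>{c \<in> Y. k \<le> T c}. z (content c))"

definition prepend_box :: "box set \<Rightarrow> box \<Rightarrow> (box \<Rightarrow> nat) \<Rightarrow> box \<Rightarrow> nat" where
  "prepend_box Y a T = restrict (\<lambda>c. if c = a then 1 else Suc (T c)) Y"

lemma standard_fillingsD:
  assumes "T \<in> standard_fillings Y"
  shows "T \<in> extensional Y" "bij_betw T Y {1..card Y}"
    "\<And>i j. (i, j) \<in> Y \<Longrightarrow> (i, j + 1) \<in> Y \<Longrightarrow> T (i, j) < T (i, j + 1)"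
    "\<And>i j. (i, j) \<in> Y \<Longrightarrow> (i + 1, j) \<in> Y \<Longrightarrow> T (i, j) < T (i + 1, j)"
  using assms unfolding standard_fillings_def by blast+

lemma standard_fillingsI:
  assumes "T \<in> extensional Y" "bij_betw T Y {1..card Y}"
    "\<And>i j. (i, j) \<in> Y \<Longrightarrow> (i, j + 1) \<in> Y \<Longrightarrow> T (i, j) < T (i, j + 1)"
    "\<And>i j. (i, j) \<in> Y \<Longrightarrow> (i + 1, j) \<in> Y \<Longrightarrow> T (i, j) < T (i + 1, j)"
  shows "T \<in> standard_fillings Y"
  unfolding standard_fillings_def using assms by blast

lemma standard_filling_ge_1: "T \<in> standard_fillings Y \<Longrightarrow> c \<in> Y \<Longrightarrow> 1 \<le> T c"
  using standard_fillingsD(2)[of T Y] bij_betwE by fastforce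

lemma finite_standard_fillings:
  assumes "finite Y"
  shows "finite (standard_fillings Y)"
proof (rule finite_subset)
  show "standard_fillings Y \<subseteq> (\<Pi>\<^sub>E c\<in>Y. {1..card Y})"
  proof
    fix T assume "T \<in> standard_fillings Y"
    note T = standard_fillingsD(1,2)[OF this]
    show "T \<in> (\<Pi>\<^sub>E c\<in>Y. {1..card Y})"
      using T(1) bij_betwE[OF T(2)] by (simp add: PiE_def Pi_def)
  qed
  show "finite (\<Pi>\<^sub>E c\<in>Y. {1..card Y})" using assms by (rule finite_PiE) simp
qed

lemma standard_fillings_empty: "standard_fillings {} = {\<lambda>_. undefined}"
  by (auto simp: standard_fillings_def bij_betw_def)

lemma prepend_box_mem:
  assumes "young S" "young M" "a \<in> addable M" "a \<in> S" "T \<in> standard_fillings (S - M - {a})"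
  shows "prepend_box (S - M) a T \<in> standard_fillings (S - M)"
proof -
  define Y where "Y = S - M"
  let ?T = "prepend_box Y a T"
  have fin: "finite Y" using young_finite[OF assms(1)] by (simp add: Y_def)
  have aY: "a \<in> Y" using assms(3,4) by (simp add: Y_def addable_def)
  have T: "T \<in> standard_fillings (Y - {a})" using assms(5) by (simp add: Y_def)
  note TD = standard_fillingsD[OF T]
  have Ta: "?T a = 1" using aY by (simp add: prepend_box_def)
  have Tc: "?T c = Suc (T c)" if "c \<in> Y" "c \<noteq> a" for c
    using that by (simp add: prepend_box_def)
  have ge: "1 \<le> T c" if "c \<in> Y" "c \<noteq> a" for c
    using standard_filling_ge_1[OF T] that by simp
  have cY: "card Y = Suc (card (Y - {a}))" using fin aY by (rule card.remove)
  have "?T ` Y = insert 1 (?T ` (Y - {a}))" using aY Ta by (metis image_insert insert_Diff)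
  also have "?T ` (Y - {a}) = Suc ` T ` (Y - {a})"
    unfolding image_image by (rule image_cong[OF refl], rule Tc) auto
  also have "T ` (Y - {a}) = {1..card (Y - {a})}"
    using TD(2) by (rule bij_betw_imp_surj_on)
  also have "insert 1 (Suc ` {1..card (Y - {a})}) = {1..card Y}"
    unfolding cY by (simp add: image_Suc_atLeastAtMost atLeastAtMost_insertL)
  finally have im: "?T ` Y = {1..card Y}" .
  moreover have "inj_on ?T Y" using im fin by (intro eq_card_imp_inj_on) simp_all
  ultimately have bij: "bij_betw ?T Y {1..card Y}" by (simp add: bij_betw_def)
  \<comment> \<open>An addable box has no left or upper neighbour in \<open>S - M\<close>, so its
    entry 1 violates no inequality.\<close>
  have ne: "a \<noteq> (i, j + 1)" "a \<noteq> (i + 1, j)" if "(i, j) \<in> Y" for i j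
  proof -
    have "1 \<le> i" "1 \<le> j" "(i, j) \<notin> M"
      using that young_pos[OF assms(1), of i j] by (auto simp: Y_def)
    then show "a \<noteq> (i, j + 1)" "a \<noteq> (i + 1, j)"
      using assms(3) addable_iff[OF assms(2), of i "j + 1"] addable_iff[OF assms(2), of "i + 1" j]
      by auto
  qed
  have less: "?T c < ?T d" if "c \<in> Y" "d \<in> Y" "d \<noteq> a" "c \<noteq> a \<Longrightarrow> T c < T d" for c d
    using that Ta Tc[of c] Tc[of d] ge[of d] by (cases "c = a") auto
  have "?T \<in> standard_fillings Y"
  proof (rule standard_fillingsI)
    show "?T \<in> extensional Y" by (simp add: prepend_box_def)
  next
    fix i j assume "(i, j) \<in> Y" "(i, j + 1) \<in> Y"
    then show "?T (i, j) < ?T (i, j + 1)"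
      using ne(1)[of i j] TD(3)[of i j] by (intro less) auto
  next
    fix i j assume "(i, j) \<in> Y" "(i + 1, j) \<in> Y"
    then show "?T (i, j) < ?T (i + 1, j)"
      using ne(2)[of i j] TD(4)[of i j] by (intro less) auto
  qed (rule bij)
  then show ?thesis by (simp add: Y_def)
qed

lemma remove_first_box_mem:
  assumes "finite Y" "a \<in> Y" "T \<in> standard_fillings Y" "T a = 1"
  shows "restrict (\<lambda>c. T c - 1) (Y - {a}) \<in> standard_fillings (Y - {a})"
    and "\<And>c. c \<in> Y \<Longrightarrow> c \<noteq> a \<Longrightarrow> 2 \<le> T c"
proof -
  let ?T = "restrict (\<lambda>c. T c - 1) (Y - {a})"
  note TD = standard_fillingsD[OF assms(3)]
  have inj: "inj_on T Y" using TD(2) by (rule bij_betw_imp_inj_on)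
  have ge1: "1 \<le> T c" if "c \<in> Y" for c using standard_filling_ge_1[OF assms(3) that] .
  show ge: "2 \<le> T c" if "c \<in> Y" "c \<noteq> a" for c
  proof -
    have "T c \<noteq> T a" using inj_onD[OF inj, of c a] that assms(2) by blast
    then show ?thesis using ge1[OF that(1)] assms(4) by simp
  qed
  have cY: "card Y = Suc (card (Y - {a}))" using assms(1,2) by (rule card.remove)
  have "?T ` (Y - {a}) = (\<lambda>x. x - 1) ` T ` (Y - {a})"
    unfolding image_image by (rule image_cong) simp_all
  also have "T ` (Y - {a}) = {1..card Y} - {1}"
    using inj_on_image_set_diff[OF inj, of Y "{a}"] assms(2,4) bij_betw_imp_surj_on[OF TD(2)] by simp
  also have "{1..card Y} - {1} = Suc ` {1..card (Y - {a})}"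
    unfolding cY image_Suc_atLeastAtMost by auto
  also have "(\<lambda>x. x - 1) ` Suc ` {1..card (Y - {a})} = {1..card (Y - {a})}"
    unfolding image_image by simp
  finally have im: "?T ` (Y - {a}) = {1..card (Y - {a})}" .
  moreover have "inj_on ?T (Y - {a})" using im assms(1) by (intro eq_card_imp_inj_on) simp_all
  ultimately have bij: "bij_betw ?T (Y - {a}) {1..card (Y - {a})}" by (simp add: bij_betw_def)
  have less: "?T c < ?T d" if "c \<in> Y - {a}" "d \<in> Y - {a}" "T c < T d" for c d
    using that ge1[of c] by simp
  show "?T \<in> standard_fillings (Y - {a})"
  proof (rule standard_fillingsI)
    fix i j assume "(i, j) \<in> Y - {a}" "(i, j + 1) \<in> Y - {a}"
    then show "?T (i, j) < ?T (i, j + 1)" using TD(3)[of i j] by (intro less) auto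
  next
    fix i j assume "(i, j) \<in> Y - {a}" "(i + 1, j) \<in> Y - {a}"
    then show "?T (i, j) < ?T (i + 1, j)" using TD(4)[of i j] by (intro less) auto
  qed (simp, rule bij)
qed

text \<open>The factor for \<open>k = 1\<close> is the total weight of \<open>Y\<close>; the factor
  for \<open>k + 1\<close> is the factor of \<open>T\<close> for \<open>k\<close>, since the box
  \<open>a\<close> has dropped out and all other entries are raised by one.\<close>

lemma filling_weight_prepend:
  assumes "finite Y" "a \<in> Y"
  shows "filling_weight z Y (prepend_box Y a T) =
    filling_weight z (Y - {a}) T / (\<Sum>c\<in>Y. z (content c))"
proof -
  let ?T = "prepend_box Y a T"
  have cY: "card Y = Suc (card (Y - {a}))" using assms by (rule card.remove)
  have first: "{c \<in> Y. 1 \<le> ?T c} = Y" by (auto simp: prepend_box_def)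
  have later: "{c \<in> Y. Suc k \<le> ?T c} = {c \<in> Y - {a}. k \<le> T c}" if "1 \<le> k" for k
    using that by (auto simp: prepend_box_def split: if_splits)
  have "(\<Prod>k=1..card Y. \<Sum>c\<in>{c \<in> Y. k \<le> ?T c}. z (content c)) =
      (\<Sum>c\<in>{c \<in> Y. 1 \<le> ?T c}. z (content c)) *
      (\<Prod>k=1..card (Y - {a}). \<Sum>c\<in>{c \<in> Y. Suc k \<le> ?T c}. z (content c))"
    unfolding cY by (simp add: prod.atLeast_Suc_atMost prod.atLeast_Suc_atMost_Suc_shift del: prod.cl_ivl_Suc)
  also have "(\<Prod>k=1..card (Y - {a}). \<Sum>c\<in>{c \<in> Y. Suc k \<le> ?T c}. z (content c)) =
      (\<Prod>k=1..card (Y - {a}). \<Sum>c\<in>{c \<in> Y - {a}. k \<le> T c}. z (content c))"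
    by (intro prod.cong refl) (simp add: later)
  finally show ?thesis unfolding filling_weight_def first by simp
qed

text \<open>The fillings are grouped by the box that carries the entry 1.\<close>

lemma standard_fillings_recursion:
  assumes "young S" "young M" "S - M \<noteq> {}"
  shows "(\<Sum>T\<in>standard_fillings (S - M). filling_weight z (S - M) T) =
    (\<Sum>a\<in>addable M \<inter> S. \<Sum>T\<in>standard_fillings (S - insert a M). filling_weight z (S - insert a M) T) /
    (\<Sum>c\<in>S - M. z (content c))"
proof -
  define Y where "Y = S - M"
  have fin: "finite Y" using young_finite[OF assms(1)] by (simp add: Y_def)
  have cY: "1 \<in> {1..card Y}"
    using fin assms(3) by (simp add: Y_def Suc_le_eq card_gt_0_iff)
  have first: "inv_into Y T 1 = a \<longleftrightarrow> T a = 1" if "T \<in> standard_fillings Y" "a \<in> Y" for T a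
    using standard_fillingsD(2)[OF that(1)] that(2) cY
    by (metis bij_betw_imp_inj_on bij_betw_imp_surj_on f_inv_into_f inv_into_f_f)
  have first_addable: "inv_into Y T 1 \<in> addable M \<inter> S" if T: "T \<in> standard_fillings Y" for T
  proof -
    have mem: "inv_into Y T 1 \<in> Y"
      using standard_fillingsD(2)[OF T] cY by (metis bij_betw_imp_surj_on inv_into_into)
    obtain i j where ij: "inv_into Y T 1 = (i, j)" by force
    have Y: "(i, j) \<in> Y" using mem ij by simp
    have one: "T (i, j) = 1" using first[OF T Y] ij by simp
    have S: "(i, j) \<in> S" "(i, j) \<notin> M" using Y by (auto simp: Y_def)
    have pos: "1 \<le> i" "1 \<le> j" using young_pos[OF assms(1) S(1)] by auto
    \<comment> \<open>An upper or left neighbour within \<open>Y\<close> would need an entry smaller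
      than 1, so every such neighbour in the quadrant belongs to \<open>M\<close>.\<close>
    have l: "(i - 1, j) \<notin> Y"
      using standard_fillingsD(4)[OF T, of "i - 1" j] standard_filling_ge_1[OF T, of "(i - 1, j)"] Y one
      by fastforce
    have u: "(i, j - 1) \<notin> Y"
      using standard_fillingsD(3)[OF T, of i "j - 1"] standard_filling_ge_1[OF T, of "(i, j - 1)"] Y one
      by fastforce
    have "i = 1 \<or> (i - 1, j) \<in> M"
      using young_down[OF assms(1) S(1), of "i - 1" j] l pos by (cases "i = 1") (auto simp: Y_def)
    moreover have "j = 1 \<or> (i, j - 1) \<in> M"
      using young_down[OF assms(1) S(1), of i "j - 1"] u pos by (cases "j = 1") (auto simp: Y_def)
    ultimately show ?thesis
      unfolding ij using addable_iff[OF assms(2), of i j] S pos by simp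
  qed
  have "(\<Sum>T\<in>standard_fillings Y. filling_weight z Y T) =
      (\<Sum>a\<in>addable M \<inter> S. \<Sum>T\<in>{T \<in> standard_fillings Y. inv_into Y T 1 = a}. filling_weight z Y T)"
    using first_addable
    by (intro sum.group[symmetric] finite_standard_fillings fin finite_Int disjI1 finite_addable assms) blast
  also have "\<dots> = (\<Sum>a\<in>addable M \<inter> S.
      (\<Sum>T\<in>standard_fillings (Y - {a}). filling_weight z (Y - {a}) T) / (\<Sum>c\<in>Y. z (content c)))"
  proof (rule sum.cong[OF refl])
    fix a assume a: "a \<in> addable M \<inter> S"
    then have aY: "a \<in> Y" by (simp add: Y_def addable_def)
    have "(\<Sum>T\<in>standard_fillings (Y - {a}). filling_weight z (Y - {a}) T / (\<Sum>c\<in>Y. z (content c))) =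
        (\<Sum>T\<in>{T \<in> standard_fillings Y. inv_into Y T 1 = a}. filling_weight z Y T)"
    proof (rule sum.reindex_bij_witness[where j = "prepend_box Y a"
          and i = "\<lambda>T. restrict (\<lambda>c. T c - 1) (Y - {a})"])
      fix T assume T: "T \<in> standard_fillings (Y - {a})"
      \<comment> \<open>Off \<open>Y - {a}\<close> both functions are \<open>undefined\<close>, by
        extensionality of \<open>T\<close>.\<close>
      have "restrict (\<lambda>c. prepend_box Y a T c - 1) (Y - {a}) c = T c" for c
        using extensional_arb[OF standard_fillingsD(1)[OF T], of c]
        by (simp add: prepend_box_def restrict_def)
      then show "restrict (\<lambda>c. prepend_box Y a T c - 1) (Y - {a}) = T" by blast
      have "prepend_box Y a T \<in> standard_fillings Y"
        using prepend_box_mem[OF assms(1,2), of a T] a T by (simp add: Y_def)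
      moreover have "prepend_box Y a T a = 1" using aY by (simp add: prepend_box_def)
      ultimately show "prepend_box Y a T \<in> {T \<in> standard_fillings Y. inv_into Y T 1 = a}"
        using first[OF _ aY] by simp
      show "filling_weight z Y (prepend_box Y a T) = filling_weight z (Y - {a}) T / (\<Sum>c\<in>Y. z (content c))"
        by (rule filling_weight_prepend[OF fin aY])
    next
      fix T assume "T \<in> {T \<in> standard_fillings Y. inv_into Y T 1 = a}"
      then have T: "T \<in> standard_fillings Y" "T a = 1" using first[OF _ aY] by auto
      show "restrict (\<lambda>c. T c - 1) (Y - {a}) \<in> standard_fillings (Y - {a})"
        by (rule remove_first_box_mem(1)[OF fin aY T])
      have "prepend_box Y a (restrict (\<lambda>c. T c - 1) (Y - {a})) c = T c" for c
        using extensional_arb[OF standard_fillingsD(1)[OF T(1)], of c]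
          remove_first_box_mem(2)[OF fin aY T, of c] T(2)
        by (cases "c \<in> Y"; cases "c = a") (auto simp: prepend_box_def)
      then show "prepend_box Y a (restrict (\<lambda>c. T c - 1) (Y - {a})) = T" by blast
    qed
    then show "(\<Sum>T\<in>{T \<in> standard_fillings Y. inv_into Y T 1 = a}. filling_weight z Y T) =
        (\<Sum>T\<in>standard_fillings (Y - {a}). filling_weight z (Y - {a}) T) / (\<Sum>c\<in>Y. z (content c))"
      by (simp add: sum_divide_distrib)
  qed
  also have "\<dots> = (\<Sum>a\<in>addable M \<inter> S. \<Sum>T\<in>standard_fillings (S - insert a M).
        filling_weight z (S - insert a M) T) / (\<Sum>c\<in>Y. z (content c))"
    by (simp add: sum_divide_distrib Y_def Diff_insert2[symmetric] Diff_insert[symmetric])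
  finally show ?thesis by (simp add: Y_def)
qed

section \<open>The hook formula\<close>

lemma int_telescope:
  fixes f :: "int \<Rightarrow> 'a::ab_group_add"
  assumes "a \<le> b + 1"
  shows "(\<Sum>q\<in>{a..b}. f q - f (q - 1)) = f b - f (a - 1)"
proof -
  have "a - 1 \<le> b" using assms by simp
  then show ?thesis
  proof (induction b rule: int_ge_induct)
    case (step b)
    have "{a..b + 1} = insert (b + 1) {a..b}" using step(1) by auto
    then show ?case using step(2) by simp
  qed simp
qed

text \<open>Lets arbitrary variables \<open>z\<close> be written as differences of a potential. The
  witness consists of signed partial sums with value 0 at 0.\<close>

lemma exists_antidifference:
  fixes z :: "int \<Rightarrow> 'a::ab_group_add"
  obtains w where "\<And>m. w m - w (m - 1) = z m"
proof
  fix m :: int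
  let ?w = "\<lambda>m. if 0 \<le> m then \<Sum>l\<in>{1..m}. z l else - (\<Sum>l\<in>{m + 1..0}. z l)"
  show "?w m - ?w (m - 1) = z m"
  proof (cases "1 \<le> m")
    case True
    then have "{1..m} = insert m {1..m - 1}" by auto
    then show ?thesis using True by simp
  next
    case False
    then have "{m..0} = insert m {m + 1..0}" by auto
    then show ?thesis using False by simp
  qed
qed

definition hook_boxes :: "box set \<Rightarrow> box \<Rightarrow> box set" where
  "hook_boxes S c = {(fst c, k) | k. (fst c, k) \<in> S \<and> snd c \<le> k} \<union>
     {(k, snd c) | k. (k, snd c) \<in> S \<and> fst c \<le> k}"

lemma hook_potential_eq_sum:
  assumes "young S" "c \<in> S"
  shows "hook_potential w S c = (\<Sum>d\<in>hook_boxes S c. w (content d) - w (content d - 1))"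
proof -
  obtain i j where c: "c = (i, j)" by force
  have ij: "(i, j) \<in> S" using assms(2) c by simp
  have pos: "1 \<le> i" "1 \<le> j" using young_pos[OF assms(1) ij] by auto
  let ?R = "row_length S i" and ?C = "col_length S j"
  have le: "j \<le> ?R" "i \<le> ?C"
    using ij row_iff[OF assms(1) pos(1)] col_iff[OF assms(1) pos(2)] by auto
  have row: "(i, k) \<in> S \<longleftrightarrow> k \<le> ?R" if "j \<le> k" for k
    using row_iff[OF assms(1) pos(1), of k] pos that by simp
  have col: "(k, j) \<in> S \<longleftrightarrow> k \<le> ?C" if "i \<le> k" for k
    using col_iff[OF assms(1) pos(2), of k] pos that by simp
  \<comment> \<open>The box \<open>c\<close> is counted with its row, so the leg starts at
    \<open>i + 1\<close> and may be empty.\<close>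
  have hook: "hook_boxes S c = Pair i ` {j..?R} \<union> (\<lambda>k. (k, j)) ` {i + 1..?C}"
    unfolding hook_boxes_def c using row col le ij by (auto simp: image_iff) 
  have "(\<Sum>d\<in>hook_boxes S c. w (content d) - w (content d - 1)) =
      (\<Sum>d\<in>Pair i ` {j..?R}. w (content d) - w (content d - 1)) +
      (\<Sum>d\<in>(\<lambda>k. (k, j)) ` {i + 1..?C}. w (content d) - w (content d - 1))"
    unfolding hook by (rule sum.union_disjoint) auto
  also have "(\<Sum>d\<in>Pair i ` {j..?R}. w (content d) - w (content d - 1)) =
      (\<Sum>k\<in>{j..?R}. w (k - i) - w (k - 1 - i))"
    by (subst sum.reindex) (auto simp: inj_on_def algebra_simps)
  also have "\<dots> = w (?R - i) - w (j - 1 - i)"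
    by (rule int_telescope[of j ?R "\<lambda>k. w (k - i)"]) (use le in simp)
  \<comment> \<open>Contents decrease down the column, so the telescoping function is a negated
    value of \<open>w\<close>. The inner end of the leg sum cancels the inner end of the row
    sum.\<close>
  also have "(\<Sum>d\<in>(\<lambda>k. (k, j)) ` {i + 1..?C}. w (content d) - w (content d - 1)) =
      (\<Sum>k\<in>{i + 1..?C}. - w (j - k - 1) - - w (j - (k - 1) - 1))"
    by (subst sum.reindex) (auto simp: inj_on_def algebra_simps)
  also have "\<dots> = - w (j - ?C - 1) - - w (j - (i + 1 - 1) - 1)"
    by (rule int_telescope[of "i + 1" ?C "\<lambda>k. - w (j - k - 1)"]) (use le in simp)
  finally show ?thesis by (simp add: hook_potential_def c algebra_simps)
qed

text \<open>Divided by the product of all hook weights, the excitation sum satisfies the recursion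
  that removal of the entry 1 gives for tableaux. The hypothesis \<open>nonzero\<close> keeps both
  the hook weights and the total weights of skew shapes invertible.\<close>

lemma hook_formula_skew:
  fixes z :: "int \<Rightarrow> 'a::field"
  assumes nonzero: "\<And>A :: box set. finite A \<Longrightarrow> A \<noteq> {} \<Longrightarrow> (\<Sum>c\<in>A. z (content c)) \<noteq> 0"
    and "young S" "young M" "M \<subseteq> S"
  shows "(\<Sum>T\<in>standard_fillings (S - M). filling_weight z (S - M) T) =
    (\<Sum>E\<in>excitations_in S M. \<Prod>c\<in>S - E. 1 / (\<Sum>d\<in>hook_boxes S c. z (content d)))"
proof -
  obtain w where w: "\<And>m. w m - w (m - 1) = z m"
    using exists_antidifference[of z] by blast
  have fin: "finite S" by (rule young_finite[OF assms(2)])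
  define H where "H c = (\<Sum>d\<in>hook_boxes S c. z (content d))" for c
  have hook: "hook_potential w S c = H c" if "c \<in> S" for c
    using hook_potential_eq_sum[OF assms(2) that, of w] by (simp add: w H_def)
  have H: "H c \<noteq> 0" if "c \<in> S" for c
    unfolding H_def
  proof (rule nonzero)
    show "finite (hook_boxes S c)"
      by (rule finite_subset[OF _ fin]) (auto simp: hook_boxes_def)
    show "hook_boxes S c \<noteq> {}"
      using that by (cases c) (auto simp: hook_boxes_def)
  qed
  have HS: "prod H S \<noteq> 0" using H fin by simp
  have "excitation_sum w S M / prod H S =
      (\<Sum>T\<in>standard_fillings (S - M). filling_weight z (S - M) T)"
    using assms(3,4)
  proof (induction "card (S - M)" arbitrary: M rule: less_induct)
    case less
    show ?case
    proof (cases "S - M = {}")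
      case True
      \<comment> \<open>In the base case the only excitation is \<open>S\<close>, and the only
        filling of the empty shape has the empty product as its denominator; both sides are
        1.\<close>
      then have "M = S" using less(3) by blast
      moreover have "excitation_sum w S S = prod H S"
        unfolding excitation_sum_def excitations_in_self[OF assms(2)] using hook by simp
      ultimately show ?thesis
        using HS by (simp add: standard_fillings_empty filling_weight_def)
    next
      case False
      have cw: "content_weight w S - content_weight w M = (\<Sum>c\<in>S - M. z (content c))"
        unfolding content_weight_def w using fin less(3) by (simp add: sum_diff finite_subset)
      have W: "(\<Sum>c\<in>S - M. z (content c)) \<noteq> 0"
        using nonzero[of "S - M"] fin False by simp
      have "(\<Sum>c\<in>S - M. z (content c)) * excitation_sum w S M =
          (\<Sum>a\<in>addable M. excitation_sum w S (insert a M))"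
        unfolding cw[symmetric] by (rule excitation_sum_recursion[OF assms(2) less(2)])
      also have "\<dots> = (\<Sum>a\<in>addable M \<inter> S. excitation_sum w S (insert a M))"
      proof (rule sum.mono_neutral_right)
        show "\<forall>a\<in>addable M - addable M \<inter> S. excitation_sum w S (insert a M) = 0"
        proof
          fix a assume a: "a \<in> addable M - addable M \<inter> S"
          then have "excitations_in S (insert a M) = {}"
            using excitations_in_subset[OF assms(2) young_addable[of a M]] by blast
          then show "excitation_sum w S (insert a M) = 0" by (simp add: excitation_sum_def)
        qed
      qed (use finite_addable[OF less(2)] in auto)
      also have "\<dots> = (\<Sum>a\<in>addable M \<inter> S. prod H S *
          (\<Sum>T\<in>standard_fillings (S - insert a M). filling_weight z (S - insert a M) T))"
      proof (rule sum.cong[OF refl])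
        fix a assume a: "a \<in> addable M \<inter> S"
        then have "S - insert a M \<subset> S - M" by (auto simp: addable_def)
        then have "card (S - insert a M) < card (S - M)"
          using fin by (intro psubset_card_mono) simp_all
        moreover have "young (insert a M)" using a young_addable by blast
        moreover have "insert a M \<subseteq> S" using a less(3) by blast
        ultimately show "excitation_sum w S (insert a M) = prod H S *
            (\<Sum>T\<in>standard_fillings (S - insert a M). filling_weight z (S - insert a M) T)"
          using less(1)[of "insert a M"] HS by (simp add: field_simps)
      qed
      finally show ?thesis
        unfolding standard_fillings_recursion[OF assms(2) less(2) False] sum_distrib_left[symmetric]
        using W HS by (simp add: field_simps)
    qed
  qed
  \<comment> \<open>Dividing the hooks in \<open>E\<close> by all hooks leaves the reciprocals of
    those outside \<open>E\<close>.\<close>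
  moreover have "excitation_sum w S M / prod H S = (\<Sum>E\<in>excitations_in S M. \<Prod>c\<in>S - E. 1 / H c)"
    unfolding excitation_sum_def sum_divide_distrib
  proof (rule sum.cong[OF refl])
    fix E assume "E \<in> excitations_in S M"
    then have E: "E \<subseteq> S" by (simp add: excitations_in_def)
    then have "(\<Prod>c\<in>E. hook_potential w S c) = prod H E"
      using hook by (intro prod.cong) auto
    moreover have "prod H S = prod H (S - E) * prod H E"
      by (rule prod.subset_diff[OF E fin])
    moreover have "prod H E \<noteq> 0" using HS calculation(2) by auto
    ultimately show "(\<Prod>c\<in>E. hook_potential w S c) / prod H S = (\<Prod>c\<in>S - E. 1 / H c)"
      by (simp add: prod_dividef)
  qed
  ultimately show ?thesis by (simp add: H_def)
qed

section \<open>Passage from order ideals back to partitions and rational functions\<close>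

lemma in_diagram_iff: "(i, j) \<in> diagram lam \<longleftrightarrow> 1 \<le> i \<and> 1 \<le> j \<and> j \<le> int (lam (nat i))"
  by (auto simp: diagram_def skew_diagram_def)

lemma skew_diagram_eq_Diff: "skew_diagram lam mu = diagram lam - diagram mu"
  by (auto simp: diagram_def skew_diagram_def)

lemma young_diagram:
  assumes "is_partition lam"
  shows "young (diagram lam)"
proof (rule youngI)
  \<comment> \<open>The value of \<open>lam\<close> at 0 is arbitrary, so monotonicity holds from
    index 1 on.\<close>
  have anti: "lam b \<le> lam a" if "1 \<le> a" "a \<le> b" for a b
    using that(2)
  proof (induction rule: dec_induct)
    case (step n)
    then show ?case using assms that(1) unfolding is_partition_def by (meson le_trans)
  qed simp
  obtain N where N: "\<And>i. N \<le> i \<Longrightarrow> lam i = 0"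
    using assms unfolding is_partition_def by blast
  have "diagram lam \<subseteq> {1..int N} \<times> {1..int (lam 1)}"
  proof
    fix c assume "c \<in> diagram lam"
    moreover obtain i j where "c = (i, j)" by force
    ultimately have c: "c = (i, j)" "1 \<le> i" "1 \<le> j" "j \<le> int (lam (nat i))"
      by (simp_all add: in_diagram_iff)
    then have "\<not> N \<le> nat i" using N[of "nat i"] by auto
    moreover have "lam (nat i) \<le> lam 1" using anti[of 1 "nat i"] c(2) by simp
    ultimately show "c \<in> {1..int N} \<times> {1..int (lam 1)}" using c by simp
  qed
  then show "finite (diagram lam)" by (rule finite_subset) simp
  fix i j i' j'
  assume "(i, j) \<in> diagram lam" "1 \<le> i'" "i' \<le> i" "1 \<le> j'" "j' \<le> j"
  moreover from this have "lam (nat i) \<le> lam (nat i')" by (intro anti) auto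
  ultimately show "(i', j') \<in> diagram lam" by (auto simp: in_diagram_iff)
qed (simp_all add: in_diagram_iff)

lemma hook_weight_eq: "hook_weight lam c = (\<Sum>d\<in>hook_boxes (diagram lam) c. zvar (content d))"
proof -
  have "hook lam c = hook_boxes (diagram lam) c"
    by (cases c) (simp add: hook_def hook_boxes_def)
  then show ?thesis unfolding hook_weight_def by (simp add: content_def case_prod_beta)
qed

lemma z_tab_eq:
  assumes "T \<in> standard_fillings Y" "Y = skew_diagram lam mu"
  shows "z_tab lam mu T = filling_weight zvar Y T"
proof -
  have T: "inj_on T Y" "T ` Y = {1..card Y}"
    using standard_fillingsD(2)[OF assms(1)] by (auto simp: bij_betw_def)
  have "(\<Sum>l=k..card Y. zvar (tab_content Y T l)) = (\<Sum>c\<in>{c \<in> Y. k \<le> T c}. zvar (content c))"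
    if k: "k \<in> {1..card Y}" for k
  proof -
    have "{k..card Y} = T ` {c \<in> Y. k \<le> T c}"
    proof (intro set_eqI iffI)
      fix l assume "l \<in> {k..card Y}"
      then have "l \<in> T ` Y" "k \<le> l" using k unfolding T(2) by auto
      then show "l \<in> T ` {c \<in> Y. k \<le> T c}" by blast
    next
      fix l assume "l \<in> T ` {c \<in> Y. k \<le> T c}"
      then have "l \<in> T ` Y" "k \<le> l" by blast+
      then show "l \<in> {k..card Y}" unfolding T(2) by simp
    qed
    moreover have "inj_on T {c \<in> Y. k \<le> T c}" by (rule inj_on_subset[OF T(1)]) blast
    ultimately have "(\<Sum>l=k..card Y. zvar (tab_content Y T l)) =
        (\<Sum>c\<in>{c \<in> Y. k \<le> T c}. zvar (tab_content Y T (T c)))"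
      by (simp add: sum.reindex)
    also have "\<dots> = (\<Sum>c\<in>{c \<in> Y. k \<le> T c}. zvar (content c))"
      using the_inv_into_f_f[OF T(1)] by (intro sum.cong refl) (simp add: tab_content_def content_def case_prod_beta)
    finally show ?thesis .
  qed
  then show ?thesis
    unfolding z_tab_def Let_def assms(2)[symmetric] filling_weight_def by simp
qed

text \<open>The coefficient of each variable counts the boxes of that content, so over the rationals
  nothing cancels and the coefficient belonging to any box of \<open>A\<close> is positive.\<close>

lemma sum_zvar_content_nonzero:
  fixes A :: "box set"
  assumes "finite A" "A \<noteq> {}"
  shows "(\<Sum>c\<in>A. zvar (content c)) \<noteq> 0"
proof -
  define P :: "int \<Rightarrow> zpoly" where "P m = Poly_Mapping.single (Poly_Mapping.single m 1) 1" for m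
  have "(\<Sum>c\<in>A. zvar (content c)) = Fract (\<Sum>c\<in>A. P (content c)) 1"
    using assms(1) by (induction rule: finite_induct) (simp_all add: zvar_def P_def Zero_fract_def)
  moreover have "(\<Sum>c\<in>A. P (content c)) \<noteq> 0"
  proof
    assume zero: "(\<Sum>c\<in>A. P (content c)) = 0"
    obtain a where a: "a \<in> A" using assms(2) by blast
    let ?m = "Poly_Mapping.single (content a) (1 :: nat)"
    have "0 < (\<Sum>c\<in>A. Poly_Mapping.lookup (P (content c)) ?m)"
      by (rule sum_pos2[OF assms(1) a]) (simp_all add: P_def lookup_single when_def)
    also have "\<dots> = Poly_Mapping.lookup (\<Sum>c\<in>A. P (content c)) ?m"
      by (rule lookup_sum[symmetric])
    finally show False using zero by simp
  qed
  ultimately show ?thesis by (simp add: Zero_fract_def eq_fract)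
qed

theorem theorem3p1:
  fixes lam mu :: "nat \<Rightarrow> nat"
  assumes "is_partition lam" and "is_partition mu" and "part_contains lam mu"
  shows "(\<Sum>T\<in>SYT lam mu. z_tab lam mu T) =
    (\<Sum>E\<in>excitations lam mu. \<Prod>c\<in>diagram lam - E. 1 / hook_weight lam c)"
proof -
  have sub: "diagram mu \<subseteq> diagram lam"
  proof
    fix c assume "c \<in> diagram mu"
    moreover obtain i j where "c = (i, j)" by force
    ultimately have c: "c = (i, j)" "1 \<le> i" "1 \<le> j" "j \<le> int (mu (nat i))"
      by (simp_all add: in_diagram_iff)
    moreover have "mu (nat i) \<le> lam (nat i)"
      using assms(3) c(2) unfolding part_contains_def by (simp add: nat_le_iff le_nat_iff)
    ultimately show "c \<in> diagram lam" by (simp add: in_diagram_iff)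
  qed
  have "SYT lam mu = standard_fillings (skew_diagram lam mu)"
    by (simp add: SYT_def standard_fillings_def Let_def)
  then have "(\<Sum>T\<in>SYT lam mu. z_tab lam mu T) =
      (\<Sum>T\<in>standard_fillings (skew_diagram lam mu). filling_weight zvar (skew_diagram lam mu) T)"
    using z_tab_eq by simp
  also have "\<dots> = (\<Sum>E\<in>excitations_in (diagram lam) (diagram mu).
      \<Prod>c\<in>diagram lam - E. 1 / (\<Sum>d\<in>hook_boxes (diagram lam) c. zvar (content d)))"
    unfolding skew_diagram_eq_Diff
    by (intro hook_formula_skew sum_zvar_content_nonzero young_diagram assms sub)
  finally show ?thesis
    by (simp add: hook_weight_eq excitations_def excitations_in_def)
qed

end
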